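(* Let $\Gamma$ be a finitely generated group and $S=S^{-1}\subset\Gamma$ a symmetric finite generating set, with Laplacian $\Delta=|S|\cdot\mathbf{1}-\sum_{s\in S}s\in\mathbb{R}[\Gamma]$. Then either (1) there exist a real number $\varepsilon>0$ and finitely many elements $\omega_1,\dots,\omega_n$ of the augmentation ideal $\mathrm{I}[\Gamma]$ such that $\Delta^2-\varepsilon\Delta=\sum_{i=1}^n\omega_i^*\omega_i$ in $\mathbb{R}[\Gamma]$, or (2) there exist an orthogonal representation $\pi$ of $\Gamma$ on a real Hilbert space $\mathcal{H}$ and a non-trivial (i.e. not identically zero) 1-cocycle $c\colon\Gamma\to\mathcal{H}$ for $\pi$ that is harmonic, i.e. that satisfies $\sum_{s\in S}c(s)=0$.
   Context: $\mathbf{1}$ denotes the neutral element of $\Gamma$ (and the unit of the group algebra $\mathbb{R}[\Gamma]$). The augmentation ideal is $\mathrm{I}[\Gamma]=\{\sum_i\lambda_i\gamma_i\mid\gamma_i\in\Gamma,\ \lambda_i\in\mathbb{R},\ \sum_i\lambda_i=0\}\subset\mathbb{R}[\Gamma]$ (finite sums). The involution on $\mathbb{R}[\Gamma]$ is $(\sum_i\lambda_i\gamma_i)^*=\sum_i\lambda_i\gamma_i^{-1}$. A 1-cocycle for an orthogonal representation $\pi$ of $\Gamma$ on a real Hilbert space $\mathcal{H}$ is a map $c\colon\Gamma\to\mathcal{H}$ with $c(\mathbf{1})=0$ and $c(\gamma_1\gamma_2)=c(\gamma_1)+\pi(\gamma_1)c(\gamma_2)$ for all $\gamma_1,\gamma_2\in\Gamma$.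 *)

theory Defs
  imports "HOL-Analysis.Analysis" "HOL-Analysis.Finite_Function_Topology"
    "HOL-Library.Function_Algebras"
begin

text \<open>
  The group \<open>\<Gamma>\<close> is a type of class \<^class>\<open>group_add\<close>, i.e. a not necessarily commutative group
  written additively: \<open>0\<close> is the neutral element, \<open>g + h\<close> the product, \<open>- g\<close> the inverse.
  With this convention the ring structure of \<^theory>\<open>HOL-Library.Poly_Mapping\<close>, where
  multiplication is convolution, makes \<open>'g \<Rightarrow>\<^sub>0 real\<close> the real group algebra of \<open>\<Gamma>\<close>; the group
  element \<open>g\<close> corresponds to \<open>Poly_Mapping.single g 1\<close> and the unit to \<open>1\<close>.
\<close>

inductive_set generated_subgroup :: "'g::group_add set \<Rightarrow> 'g set" for S where
  zero: "0 \<in> generated_subgroup S"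
| incl: "s \<in> S \<Longrightarrow> s \<in> generated_subgroup S"
| minus: "g \<in> generated_subgroup S \<Longrightarrow> - g \<in> generated_subgroup S"
| plus: "g \<in> generated_subgroup S \<Longrightarrow> h \<in> generated_subgroup S \<Longrightarrow> g + h \<in> generated_subgroup S"

definition augmentation_ideal :: "('g::group_add \<Rightarrow>\<^sub>0 real) set" where
  "augmentation_ideal = {a. (\<Sum>g\<in>Poly_Mapping.keys a. Poly_Mapping.lookup a g) = 0}"

definition star :: "('g::group_add \<Rightarrow>\<^sub>0 real) \<Rightarrow> ('g \<Rightarrow>\<^sub>0 real)" where
  "star a = (\<Sum>g\<in>Poly_Mapping.keys a. Poly_Mapping.single (- g) (Poly_Mapping.lookup a g))"

definition laplacian :: "'g::group_add set \<Rightarrow> ('g \<Rightarrow>\<^sub>0 real)" where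
  "laplacian S = real (card S) *\<^sub>R 1 - (\<Sum>s\<in>S. Poly_Mapping.single s 1)"


text \<open>
  HOL cannot quantify existentially over types, so the classes \<^class>\<open>real_inner\<close> and
  \<^class>\<open>complete_space\<close> cannot express that some real Hilbert space exists. A Hilbert space is
  therefore given by a linear subspace \<open>H\<close> of some real vector space together with an
  arbitrary inner product on \<open>H\<close>.
\<close>

locale real_hilbert_space =
  fixes H :: "'v::real_vector set" and ip :: "'v \<Rightarrow> 'v \<Rightarrow> real"
  assumes subspace_H: "subspace H"
    and ip_commute: "x \<in> H \<Longrightarrow> y \<in> H \<Longrightarrow> ip x y = ip y x"
    and ip_add_left: "x \<in> H \<Longrightarrow> y \<in> H \<Longrightarrow> z \<in> H \<Longrightarrow> ip (x + y) z = ip x z + ip y z"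
    and ip_scaleR_left: "x \<in> H \<Longrightarrow> y \<in> H \<Longrightarrow> ip (r *\<^sub>R x) y = r * ip x y"
    and ip_ge_zero: "x \<in> H \<Longrightarrow> 0 \<le> ip x x"
    and ip_eq_zero: "x \<in> H \<Longrightarrow> ip x x = 0 \<Longrightarrow> x = 0"
    and complete: "(\<And>n. X n \<in> H) \<Longrightarrow>
          (\<forall>e>0. \<exists>M. \<forall>m\<ge>M. \<forall>n\<ge>M. sqrt (ip (X m - X n) (X m - X n)) < e) \<Longrightarrow>
          \<exists>x\<in>H. (\<lambda>n. sqrt (ip (X n - x) (X n - x))) \<longlonglongrightarrow> 0"

text \<open>
  Surjectivity of each \<open>\<pi> g\<close> on \<open>H\<close> need not be required: the inverse is \<open>\<pi> (- g)\<close>.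
\<close>

locale orthogonal_representation = real_hilbert_space H ip
  for H :: "'v::real_vector set" and ip :: "'v \<Rightarrow> 'v \<Rightarrow> real" +
  fixes \<pi> :: "'g::group_add \<Rightarrow> 'v \<Rightarrow> 'v"
  assumes rep_closed: "x \<in> H \<Longrightarrow> \<pi> g x \<in> H"
    and rep_add: "x \<in> H \<Longrightarrow> y \<in> H \<Longrightarrow> \<pi> g (x + y) = \<pi> g x + \<pi> g y"
    and rep_scaleR: "x \<in> H \<Longrightarrow> \<pi> g (r *\<^sub>R x) = r *\<^sub>R \<pi> g x"
    and rep_ip: "x \<in> H \<Longrightarrow> y \<in> H \<Longrightarrow> ip (\<pi> g x) (\<pi> g y) = ip x y"
    and rep_neutral: "x \<in> H \<Longrightarrow> \<pi> 0 x = x"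
    and rep_mult: "x \<in> H \<Longrightarrow> \<pi> (g + h) x = \<pi> g (\<pi> h x)"

locale one_cocycle = orthogonal_representation H ip \<pi>
  for H :: "'v::real_vector set" and ip :: "'v \<Rightarrow> 'v \<Rightarrow> real" and \<pi> :: "'g::group_add \<Rightarrow> 'v \<Rightarrow> 'v" +
  fixes c :: "'g \<Rightarrow> 'v"
  assumes cocycle_closed: "c g \<in> H"
    and cocycle_neutral: "c 0 = 0"
    and cocycle_mult: "c (g + h) = c g + \<pi> g (c h)"


text \<open>
  The ambient vector space used for Hilbert spaces carrying a cocycle of \<open>\<Gamma>\<close> is \<open>'g \<Rightarrow> real\<close>,
  with pointwise operations. This loses no generality: for any cocycle \<open>c\<close>, the map sending
  \<open>v\<close> to the function \<open>g \<mapsto> \<langle>v, c g\<rangle>\<close> is injective on the closed span of the values of \<open>c\<close>.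
  The lemma \<open>one_cocycle_in_functions\<close> below makes this precise.
\<close>

instantiation "fun" :: (type, real_vector) real_vector
begin

definition scaleR_fun :: "real \<Rightarrow> ('a \<Rightarrow> 'b) \<Rightarrow> 'a \<Rightarrow> 'b" where
  "scaleR_fun r f = (\<lambda>x. r *\<^sub>R f x)"

instance
  by standard (auto simp: scaleR_fun_def fun_eq_iff scaleR_add_left scaleR_add_right)

end

lemma one_cocycle_in_functions:
  fixes \<pi> :: "'g::group_add \<Rightarrow> 'h::{real_inner,complete_space} \<Rightarrow> 'h" and c :: "'g \<Rightarrow> 'h"
  assumes "one_cocycle UNIV inner \<pi> c"
  obtains H :: "('g \<Rightarrow> real) set" and ip \<pi>' c'
  where "one_cocycle H ip \<pi>' c'" "\<And>g. c' g = 0 \<longleftrightarrow> c g = 0"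
    "\<And>S. (\<Sum>s\<in>S. c' s) = 0 \<longleftrightarrow> (\<Sum>s\<in>S. c s) = 0"
proof -
  interpret C: one_cocycle UNIV inner \<pi> c by fact
  define N where "N = {n. \<forall>g. n \<bullet> c g = 0}"
  define K where "K = {v. \<forall>n\<in>N. n \<bullet> v = 0}"
  define J where "J = (\<lambda>v g. v \<bullet> c g)"
  define I where "I = inv_into K J"
  have subK: "subspace K"
    by (auto simp: K_def subspace_def inner_add_right)
  have closedK: "closed K"
  proof -
    have "K = (\<Inter>n\<in>N. {v. n \<bullet> v = 0})" by (auto simp: K_def)
    then show ?thesis by (auto intro!: closed_INT closed_hyperplane)
  qed
  have cK: "c g \<in> K" for g by (auto simp: K_def N_def)
  have linJ: "linear J"
    by (rule linearI) (auto simp: J_def fun_eq_iff scaleR_fun_def inner_add_left)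
  have injJ: "inj_on J K"
  proof (subst linear_inj_on_iff_eq_0[OF linJ subK], safe)
    fix v assume v: "v \<in> K" "J v = 0"
    then have "v \<in> N" by (auto simp: J_def N_def fun_eq_iff)
    with v have "v \<bullet> v = 0" by (auto simp: K_def)
    then show "v = 0" by simp
  qed
  have IJ: "I (J v) = v" if "v \<in> K" for v
    using that injJ by (simp add: I_def)
  have pi_adj: "\<pi> g x \<bullet> y = x \<bullet> \<pi> (- g) y" for g x y
    by (metis C.rep_ip C.rep_mult C.rep_neutral UNIV_I add.right_inverse)
  have pi_c: "\<pi> g (c h) = c (g + h) - c g" for g h
    by (simp add: C.cocycle_mult)
  have piN: "\<pi> g n \<in> N" if "n \<in> N" for g n
    using that by (auto simp: N_def pi_adj pi_c inner_diff_right)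
  have piK: "\<pi> g v \<in> K" if "v \<in> K" for g v
  proof -
    have "n \<bullet> \<pi> g v = 0" if "n \<in> N" for n
      using piN[OF that, of "- g"] \<open>v \<in> K\<close> pi_adj[of "- g" n v] by (simp add: K_def)
    then show ?thesis by (simp add: K_def)
  qed
  note Jsimps = linear_add[OF linJ, symmetric] linear_scale[OF linJ, symmetric]
    linear_diff[OF linJ, symmetric]
  note Ksimps = subspace_add[OF subK] subspace_scale[OF subK] subspace_diff[OF subK]
  let ?H = "J ` K" and ?ip = "\<lambda>x y. I x \<bullet> I y"
  have dist_J: "sqrt (?ip (J u - J v) (J u - J v)) = dist u v" if "u \<in> K" "v \<in> K" for u v
    using that by (simp add: Jsimps IJ Ksimps dist_norm norm_eq_sqrt_inner)
  have "real_hilbert_space ?H ?ip"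
  proof
    show "subspace ?H" by (rule linear_subspace_image[OF linJ subK])
    fix X assume X: "\<And>n::nat. X n \<in> ?H"
      and cauchy: "\<forall>e>0. \<exists>M. \<forall>m\<ge>M. \<forall>n\<ge>M. sqrt (?ip (X m - X n) (X m - X n)) < e"
    define Y where "Y n = I (X n)" for n
    have YK: "Y n \<in> K" and XJ: "X n = J (Y n)" for n
      using X[of n] by (auto simp: Y_def IJ)
    have "Cauchy Y"
      unfolding Cauchy_def using cauchy by (simp add: XJ dist_J YK)
    then obtain y where y: "Y \<longlonglongrightarrow> y"
      using Cauchy_convergent convergent_def by blast
    have yK: "y \<in> K"
      using closed_sequentially[OF closedK _ y] YK by blast
    have "(\<lambda>n. sqrt (?ip (X n - J y) (X n - J y))) \<longlonglongrightarrow> 0"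
      using y[THEN tendsto_dist_iff[THEN iffD1]] by (simp add: XJ dist_J YK yK)
    then show "\<exists>x\<in>?H. (\<lambda>n. sqrt (?ip (X n - x) (X n - x))) \<longlonglongrightarrow> 0"
      using yK by blast
  next
    fix x y z r
    assume "x \<in> ?H" "y \<in> ?H" "z \<in> ?H"
    then show "?ip (x + y) z = ?ip x z + ?ip y z"
      by (auto simp: Jsimps IJ Ksimps inner_add_left)
  next
    fix x y r
    assume "x \<in> ?H" "y \<in> ?H"
    then show "?ip (r *\<^sub>R x) y = r * ?ip x y"
      by (auto simp: Jsimps IJ Ksimps)
  qed (auto simp: IJ linear_0[OF linJ] inner_commute)
  moreover have "orthogonal_representation_axioms ?H ?ip (\<lambda>g x. J (\<pi> g (I x)))"
    by standard (auto simp: Jsimps IJ Ksimps piK C.rep_add C.rep_scaleR C.rep_ip C.rep_neutral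
        C.rep_mult)
  moreover have "one_cocycle_axioms ?H (\<lambda>g x. J (\<pi> g (I x))) (\<lambda>g. J (c g))"
    by standard (auto simp: Jsimps IJ Ksimps cK piK C.cocycle_neutral C.cocycle_mult
        linear_0[OF linJ])
  ultimately have "one_cocycle ?H ?ip (\<lambda>g x. J (\<pi> g (I x))) (\<lambda>g. J (c g))"
    by (simp add: one_cocycle_def orthogonal_representation_def)
  moreover have J0: "J v = 0 \<longleftrightarrow> v = 0" if "v \<in> K" for v
    using IJ[OF that] IJ[OF subspace_0[OF subK]] linear_0[OF linJ] by metis
  moreover have "(\<Sum>s\<in>S. J (c s)) = 0 \<longleftrightarrow> (\<Sum>s\<in>S. c s) = 0" for S
    using J0[of "\<Sum>s\<in>S. c s"] by (simp add: linear_sum[OF linJ] subspace_sum[OF subK] cK)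
  ultimately show thesis
    using that cK by blast
qed

end

theory Submission
  imports Defs
begin

text \<open>
  Let \<open>\<Delta>\<close> be the Laplacian, \<open>I\<close> the augmentation ideal and \<open>C\<close> the convex cone of sums of
  hermitian squares \<open>\<omega>\<^sup>* \<omega>\<close> with \<open>\<omega> \<in> I\<close>. The cone orders the real span of the elements
  \<open>v\<^sup>* w + w\<^sup>* v\<close>, where \<open>v, w \<in> I\<close>, and the decisive fact is that \<open>\<Delta>\<close> is an order unit for
  this order: every \<open>\<omega>\<^sup>* \<omega>\<close> with \<open>\<omega> \<in> I\<close> lies below a multiple of \<open>\<Delta>\<close>
  (\<open>laplacian_dominated_eq_augmentation_ideal\<close>). For a generator this holds because \<open>2\<Delta>\<close> is the
  sum of the squares of all \<open>s - 1\<close>; it spreads to \<open>g - 1\<close> for all \<open>g\<close> by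
  \<open>gh - 1 = (g - 1) + g(h - 1)\<close> and the parallelogram law, and these elements span \<open>I\<close>.

  The element \<open>\<Delta>\<^sup>2 = \<Delta>\<^sup>* \<Delta>\<close> lies in \<open>C\<close>. If \<open>\<Delta>\<^sup>2 - \<epsilon>\<Delta>\<close> leaves \<open>C\<close> for every
  \<open>\<epsilon> > 0\<close>, then \<open>\<Delta>\<^sup>2\<close> is a boundary point of \<open>C\<close>, and the Hahn-Banach theorem gives a
  functional \<open>\<phi>\<close> that is nonnegative on \<open>C\<close> with \<open>\<phi>(\<Delta>) = 1\<close> and
  \<open>\<phi>(\<Delta>\<^sup>2) \<le> 0\<close> (\<open>separation_by_state\<close>). Now apply the Gelfand-Naimark-Segal
  construction to \<open>I\<close>: complete it for the form \<open>\<langle>v, w\<rangle> = \<phi>(v\<^sup>* w + w\<^sup>* v) / 2\<close>. Left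
  multiplication of \<open>\<Gamma>\<close> on \<open>I\<close> preserves the form, and \<open>c(g) = [g - 1]\<close> is a cocycle. It is
  harmonic because \<open>\<Sum>\<^sub>s c(s) = [-\<Delta>]\<close> has squared norm \<open>\<phi>(\<Delta>\<^sup>2) = 0\<close>, and it is
  nontrivial because \<open>\<Sum>\<^sub>s \<parallel>c(s)\<parallel>\<^sup>2 = 2\<phi>(\<Delta>) = 2\<close>
  (\<open>harmonic_cocycle_of_state\<close>).

  The Hilbert space has to consist of functions on \<open>\<Gamma>\<close>. A vector \<open>v\<close> of the completion is
  encoded as the function \<open>g \<mapsto> \<langle>v, c(g)\<rangle>\<close>, which determines it since the \<open>c(g)\<close> span a dense
  subspace; in these terms the representation is
  \<open>(\<pi>(g) f)(h) = f(g\<^sup>-\<^sup>1 h) - f(g\<^sup>-\<^sup>1)\<close>.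
\<close>

section \<open>Separating a boundary point from a convex cone\<close>

lemma convex_cone_add_ray:
  fixes C :: "'a::real_vector set"
  assumes cone: "convex_cone C"
  shows "convex_cone {p + t *\<^sub>R x | p t. p \<in> C \<and> 0 \<le> t}" (is "convex_cone ?Q")
    and "C \<subseteq> {p + t *\<^sub>R x | p t. p \<in> C \<and> 0 \<le> t}"
    and "x \<in> {p + t *\<^sub>R x | p t. p \<in> C \<and> 0 \<le> t}"
proof -
  have zC: "0 \<in> C" by (rule convex_cone_contains_0[OF cone])
  show sub: "C \<subseteq> ?Q"
  proof
    fix p assume "p \<in> C"
    then have "p = p + 0 *\<^sub>R x \<and> p \<in> C \<and> (0::real) \<le> 0" by simp
    then show "p \<in> ?Q" by blast
  qed
  have "x = 0 + 1 *\<^sub>R x \<and> 0 \<in> C \<and> (0::real) \<le> 1" using zC by simp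
  then show "x \<in> ?Q" by blast
  show "convex_cone ?Q"
  proof (intro convex_cone_iff[THEN iffD2] conjI ballI allI impI)
    show "0 \<in> ?Q" using zC sub by blast
    fix y z assume "y \<in> ?Q" "z \<in> ?Q"
    then obtain p s q t where "y = p + s *\<^sub>R x" "z = q + t *\<^sub>R x" "p \<in> C" "q \<in> C" "0 \<le> s" "0 \<le> t"
      by auto
    then have "y + z = (p + q) + (s + t) *\<^sub>R x" "p + q \<in> C" "0 \<le> s + t"
      by (auto simp: scaleR_add_left convex_cone_add[OF cone])
    then show "y + z \<in> ?Q" by blast
  next
    fix y and r :: real assume "y \<in> ?Q" "0 \<le> r"
    then obtain p s where "y = p + s *\<^sub>R x" "p \<in> C" "0 \<le> s" by auto
    then have "r *\<^sub>R y = r *\<^sub>R p + (r * s) *\<^sub>R x" "r *\<^sub>R p \<in> C" "0 \<le> r * s"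
      using \<open>0 \<le> r\<close> by (auto simp: scaleR_add_right convex_cone_scaleR[OF cone])
    then show "r *\<^sub>R y \<in> ?Q" by blast
  qed
qed

text \<open>
  Zorn's lemma yields a convex cone \<open>P\<close> that is maximal among those containing \<open>C\<close> but not
  \<open>- u\<close>. If \<open>x \<notin> P\<close>, then the cone spanned by \<open>P\<close> and \<open>x\<close> contains \<open>- u\<close>, say
  \<open>- u = p + t x\<close> with \<open>t > 0\<close>, so that \<open>- x\<close> is a positive multiple of \<open>p + u \<in> P\<close>. Such a
  total cone plays the part of a half-space.
\<close>
lemma maximal_cone_total:
  fixes C :: "'a::real_vector set"
  assumes cone: "convex_cone C" and u: "u \<in> C" "- u \<notin> C"
  obtains P where "convex_cone P" "C \<subseteq> P" "- u \<notin> P" "\<And>x. x \<in> P \<or> - x \<in> P"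
proof -
  define \<P> where "\<P> = {P. convex_cone P \<and> C \<subseteq> P \<and> - u \<notin> P}"
  have "\<exists>M\<in>\<P>. \<forall>X\<in>\<P>. M \<subseteq> X \<longrightarrow> X = M"
  proof (rule subset_Zorn_nonempty)
    show "\<P> \<noteq> {}" using assms by (auto simp: \<P>_def)
    fix \<C> assume ne: "\<C> \<noteq> {}" and ch: "subset.chain \<P> \<C>"
    have mem: "convex_cone P" "C \<subseteq> P" "- u \<notin> P" if "P \<in> \<C>" for P
      using ch that by (auto simp: subset_chain_def \<P>_def)
    have "convex_cone (\<Union>\<C>)"
    proof (intro convex_cone_iff[THEN iffD2] conjI ballI allI impI)
      show "0 \<in> \<Union>\<C>" using ne convex_cone_contains_0[OF mem(1)] by blast
      fix x y assume "x \<in> \<Union>\<C>" "y \<in> \<Union>\<C>"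
      then obtain X Y where "X \<in> \<C>" "x \<in> X" "Y \<in> \<C>" "y \<in> Y" by blast
      moreover from this ch have "X \<subseteq> Y \<or> Y \<subseteq> X" by (auto simp: subset_chain_def)
      ultimately obtain Z where "Z \<in> \<C>" "x \<in> Z" "y \<in> Z" by blast
      then show "x + y \<in> \<Union>\<C>" using convex_cone_add[OF mem(1)] by blast
    next
      fix x and r :: real assume "x \<in> \<Union>\<C>" "0 \<le> r"
      then show "r *\<^sub>R x \<in> \<Union>\<C>" using convex_cone_scaleR[OF mem(1)] by blast
    qed
    moreover have "C \<subseteq> \<Union>\<C>" using ne mem(2) by blast
    ultimately show "\<Union>\<C> \<in> \<P>" using mem(3) by (auto simp: \<P>_def)
  qed
  then obtain P where P: "convex_cone P" "C \<subseteq> P" "- u \<notin> P"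
    and max: "\<And>X. convex_cone X \<Longrightarrow> - u \<notin> X \<Longrightarrow> P \<subseteq> X \<Longrightarrow> X = P"
    by (auto simp: \<P>_def) 
  have "x \<in> P \<or> - x \<in> P" for x
  proof (rule ccontr)
    assume neg: "\<not> (x \<in> P \<or> - x \<in> P)"
    define Q where "Q = {p + t *\<^sub>R x | p t. p \<in> P \<and> 0 \<le> t}"
    note ray = convex_cone_add_ray[OF P(1), of x, folded Q_def]
    have "- u \<in> Q" using max[OF ray(1) _ ray(2)] ray(3) neg by blast
    then obtain p t where pt: "- u = p + t *\<^sub>R x" "p \<in> P" "0 \<le> t" by (auto simp: Q_def)
    then have "t \<noteq> 0" using P(3) by auto
    have "- (t *\<^sub>R x) = p - (p + t *\<^sub>R x)" by simp
    also have "\<dots> = p + u" unfolding pt(1)[symmetric] by simp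
    finally have "- (t *\<^sub>R x) = p + u" .
    then have "- x = inverse t *\<^sub>R (p + u)"
      using \<open>t \<noteq> 0\<close> by (metis left_inverse scaleR_minus_right scaleR_one scaleR_scaleR)
    moreover have "p + u \<in> P" using pt(2) P(2) u(1) by (auto intro: convex_cone_add[OF P(1)])
    ultimately have "- x \<in> P" using pt(3) by (simp add: convex_cone_scaleR[OF P(1)])
    then show False using neg by simp
  qed
  then show thesis using that P by blast
qed

text \<open>
  The subspace on which a functional that is nonnegative on \<open>C\<close> is controlled by its value at
  \<open>u\<close>, that is, on which \<open>u\<close> is an order unit.
\<close>
definition order_bounded :: "'a::real_vector set \<Rightarrow> 'a \<Rightarrow> 'a set" where
  "order_bounded C u = {x. \<exists>t. t *\<^sub>R u - x \<in> C \<and> t *\<^sub>R u + x \<in> C}"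

lemma order_bounded_unit:
  assumes "convex_cone C" "u \<in> C"
  shows "u \<in> order_bounded C u"
  using convex_cone_scaleR[OF assms(1) _ assms(2), of 2] convex_cone_contains_0[OF assms(1)]
  by (auto simp: order_bounded_def scaleR_2 intro!: exI[of _ 1])

lemma subspace_order_bounded:
  assumes cone: "convex_cone C" and u: "u \<in> C"
  shows "subspace (order_bounded C u)"
proof (rule subspaceI)
  note add = convex_cone_add[OF cone] and scale = convex_cone_scaleR[OF cone]
  show "0 \<in> order_bounded C u"
    using u by (auto simp: order_bounded_def intro!: exI[of _ 1])
  fix x assume "x \<in> order_bounded C u"
  then obtain s where s: "s *\<^sub>R u - x \<in> C" "s *\<^sub>R u + x \<in> C"
    by (auto simp: order_bounded_def)
  {
    fix y assume "y \<in> order_bounded C u"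
    then obtain t where "t *\<^sub>R u - y \<in> C" "t *\<^sub>R u + y \<in> C"
      by (auto simp: order_bounded_def)
    then have "(s *\<^sub>R u - x) + (t *\<^sub>R u - y) \<in> C" "(s *\<^sub>R u + x) + (t *\<^sub>R u + y) \<in> C"
      using s by (auto intro: add)
    then have "(s + t) *\<^sub>R u - (x + y) \<in> C \<and> (s + t) *\<^sub>R u + (x + y) \<in> C"
      by (simp add: algebra_simps)
    then show "x + y \<in> order_bounded C u" unfolding order_bounded_def by blast
  }
  fix r :: real
  have "\<bar>r\<bar> *\<^sub>R (s *\<^sub>R u - x) \<in> C" "\<bar>r\<bar> *\<^sub>R (s *\<^sub>R u + x) \<in> C"
    using s by (auto intro: scale)
  then have "(\<bar>r\<bar> * s) *\<^sub>R u - r *\<^sub>R x \<in> C \<and> (\<bar>r\<bar> * s) *\<^sub>R u + r *\<^sub>R x \<in> C"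
    by (cases "r \<ge> 0") (auto simp: algebra_simps minus_diff_commute)
  then show "r *\<^sub>R x \<in> order_bounded C u" unfolding order_bounded_def by blast
qed

text \<open>
  The Hahn-Banach theorem for a cone with order unit: the condition on \<open>a\<close> says that \<open>a\<close> does
  not lie in the interior of \<open>C\<close>. It also ensures that adjoining \<open>- a\<close> to \<open>C\<close> does not put
  \<open>- u\<close> into the cone, so there is a total cone \<open>P\<close> containing \<open>C\<close> and \<open>- a\<close> but not
  \<open>- u\<close>. Along each line \<open>x - t u\<close> membership in \<open>P\<close> is lost at a single value of \<open>t\<close>,
  which is \<open>\<phi> x\<close>; totality of \<open>P\<close> is what makes \<open>\<phi>\<close> additive rather than merely
  superadditive.
\<close>
lemma separation_by_state:
  fixes C :: "'a::real_vector set"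
  assumes cone: "convex_cone C" and u: "u \<in> C" and a: "a \<in> order_bounded C u"
    and nonint: "\<And>\<epsilon>. \<epsilon> > 0 \<Longrightarrow> a - \<epsilon> *\<^sub>R u \<notin> C"
  obtains \<phi> :: "'a \<Rightarrow> real" where
    "\<And>x y. x \<in> order_bounded C u \<Longrightarrow> y \<in> order_bounded C u \<Longrightarrow> \<phi> (x + y) = \<phi> x + \<phi> y"
    "\<And>r x. x \<in> order_bounded C u \<Longrightarrow> \<phi> (r *\<^sub>R x) = r * \<phi> x"
    "\<And>x. x \<in> C \<Longrightarrow> x \<in> order_bounded C u \<Longrightarrow> 0 \<le> \<phi> x"
    "\<phi> u = 1" "\<phi> a \<le> 0"
proof -
  note add = convex_cone_add[OF cone] and scale = convex_cone_scaleR[OF cone]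
  define C' where "C' = {x + t *\<^sub>R (- a) | x t. x \<in> C \<and> 0 \<le> t}"
  have zC: "0 \<in> C" by (rule convex_cone_contains_0[OF cone])
  note C' = convex_cone_add_ray(1)[OF cone, of "- a", folded C'_def]
    and C_sub = convex_cone_add_ray(2)[OF cone, of "- a", folded C'_def]
    and neg_a = convex_cone_add_ray(3)[OF cone, of "- a", folded C'_def]
  have neg_u: "- u \<notin> C'"
  proof
    assume "- u \<in> C'"
    then obtain p t where pt: "- u = p - t *\<^sub>R a" "p \<in> C" "0 \<le> t" by (auto simp: C'_def)
    show False
    proof (cases "t = 0")
      case True
      \<comment> \<open>If \<open>- u\<close> were in \<open>C\<close>, then so would be \<open>a - \<epsilon> u\<close> for large \<open>\<epsilon>\<close>.\<close>
      then have mu: "- u \<in> C" using pt by simp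
      obtain s where s: "s *\<^sub>R u + a \<in> C" using a by (auto simp: order_bounded_def)
      have "a - (\<bar>s\<bar> + 1) *\<^sub>R u = (s *\<^sub>R u + a) + (\<bar>s\<bar> + 1 + s) *\<^sub>R (- u)"
        by (simp add: algebra_simps)
      also have "\<dots> \<in> C" by (intro add s scale mu) auto
      finally show False using nonint[of "\<bar>s\<bar> + 1"] by simp
    next
      case False
      have "p = t *\<^sub>R a - u" using pt(1) by (simp add: algebra_simps)
      then have "inverse t *\<^sub>R p = a - inverse t *\<^sub>R u"
        using False by (simp add: scaleR_diff_right)
      moreover have "inverse t *\<^sub>R p \<in> C" using pt by (intro scale) auto
      ultimately show False using nonint[of "inverse t"] False pt(3) by simp
    qed
  qed
  obtain P where P: "convex_cone P" "C' \<subseteq> P" "- u \<notin> P" and total: "\<And>x. x \<in> P \<or> - x \<in> P"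
    using maximal_cone_total[OF C' _ neg_u] u C_sub by blast
  note Padd = convex_cone_add[OF P(1)] and Pscale = convex_cone_scaleR[OF P(1)]
  have pos: "0 \<le> t" if "t *\<^sub>R u \<in> P" for t
  proof (rule ccontr)
    assume "\<not> 0 \<le> t"
    then have "inverse (- t) *\<^sub>R (t *\<^sub>R u) \<in> P" by (intro Pscale that) auto
    then show False using P(3) \<open>\<not> 0 \<le> t\<close> by simp
  qed
  have uP: "t *\<^sub>R u \<in> P" if "0 \<le> t" for t
    using that u C_sub P(2) by (intro Pscale) auto
  define L where "L x = {t. x - t *\<^sub>R u \<in> P}" for x
  define \<phi> where "\<phi> x = Sup (L x)" for x
  let ?E = "order_bounded C u"
  have ne: "L x \<noteq> {}" and bdd: "bdd_above (L x)" if xE: "x \<in> ?E" for x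
  proof -
    obtain t where t: "t *\<^sub>R u - x \<in> P" "t *\<^sub>R u + x \<in> P"
      using xE C_sub P(2) by (auto simp: order_bounded_def)
    then have "- t \<in> L x" by (simp add: L_def algebra_simps)
    then show "L x \<noteq> {}" by blast
    have "s \<le> t" if "s \<in> L x" for s
    proof -
      have "(t - s) *\<^sub>R u = (t *\<^sub>R u - x) + (x - s *\<^sub>R u)" by (simp add: algebra_simps)
      also have "\<dots> \<in> P" using t that by (intro Padd) (auto simp: L_def)
      finally show ?thesis using pos by fastforce
    qed
    then show "bdd_above (L x)" by (rule bdd_aboveI)
  qed
  have below: "x - t *\<^sub>R u \<in> P" if x: "x \<in> ?E" and t: "t < \<phi> x" for x t
  proof -
    obtain s where s: "s \<in> L x" "t < s"
      using less_cSup_iff[OF ne[OF x] bdd[OF x]] t by (auto simp: \<phi>_def)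
    have "x - t *\<^sub>R u = (x - s *\<^sub>R u) + (s - t) *\<^sub>R u" by (simp add: algebra_simps)
    also have "\<dots> \<in> P" using s by (intro Padd uP) (auto simp: L_def)
    finally show ?thesis .
  qed
  have above: "t *\<^sub>R u - x \<in> P" if "x \<in> ?E" "\<phi> x < t" for x t
  proof -
    have "t \<notin> L x" using cSup_upper[OF _ bdd] that by (force simp: \<phi>_def)
    then show ?thesis using total[of "x - t *\<^sub>R u"] by (simp add: L_def)
  qed
  have le: "s \<le> t" if "x - s *\<^sub>R u \<in> P" "t *\<^sub>R u - x \<in> P" for s t x
  proof -
    have "(t - s) *\<^sub>R u = (t *\<^sub>R u - x) + (x - s *\<^sub>R u)" by (simp add: algebra_simps)
    also have "\<dots> \<in> P" by (intro Padd that)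
    finally show ?thesis using pos by fastforce
  qed
  have \<phi>_ge: "s \<le> \<phi> x" if "x \<in> ?E" "x - s *\<^sub>R u \<in> P" for x s
    using cSup_upper[OF _ bdd] that by (auto simp: \<phi>_def L_def)
  have \<phi>_le: "\<phi> x \<le> s" if "x \<in> ?E" "s *\<^sub>R u - x \<in> P" for x s
    using le[OF below[OF that(1)] that(2)] by (rule dense_le)
  \<comment> \<open>\<open>\<phi> x\<close> is characterised as the Dedekind cut of the line \<open>x - t u\<close> by \<open>P\<close> and \<open>- P\<close>.\<close>
  have \<phi>_eqI: "\<phi> x = m" if "x \<in> ?E"
    "\<And>t. t < m \<Longrightarrow> x - t *\<^sub>R u \<in> P" "\<And>t. m < t \<Longrightarrow> t *\<^sub>R u - x \<in> P" for x m
    by (rule antisym; (rule dense_ge dense_le); blast intro: \<phi>_ge \<phi>_le that)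
  have E_add: "x + y \<in> ?E" if xy: "x \<in> ?E" "y \<in> ?E" for x y
    using subspace_order_bounded[OF cone u] that by (rule subspace_add)
  show thesis
  proof
    have u': "u \<in> ?E" by (rule order_bounded_unit[OF cone u])
    show "\<phi> u = 1"
      using \<phi>_ge[OF u', of 1] \<phi>_le[OF u', of 1] convex_cone_contains_0[OF P(1)] by simp
    show "\<phi> a \<le> 0" using \<phi>_le[OF a, of 0] neg_a P(2) by auto
  next
    fix x assume "x \<in> C" "x \<in> ?E"
    then show "0 \<le> \<phi> x" using \<phi>_ge[of x 0] C_sub P(2) by auto
  next
    fix x y assume xy: "x \<in> ?E" "y \<in> ?E"
    show "\<phi> (x + y) = \<phi> x + \<phi> y"
    proof (rule \<phi>_eqI[OF E_add[OF xy]])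
      fix t assume "t < \<phi> x + \<phi> y"
      then have "t - \<phi> y < \<phi> x" by simp
      then obtain s where s: "t - \<phi> y < s" "s < \<phi> x" using dense by blast
      have "x + y - t *\<^sub>R u = (x - s *\<^sub>R u) + (y - (t - s) *\<^sub>R u)" by (simp add: algebra_simps)
      also have "\<dots> \<in> P" using s xy by (intro Padd below) auto
      finally show "x + y - t *\<^sub>R u \<in> P" .
    next
      fix t assume "\<phi> x + \<phi> y < t"
      then have "\<phi> x < t - \<phi> y" by simp
      then obtain s where s: "\<phi> x < s" "s < t - \<phi> y" using dense by blast
      have "t *\<^sub>R u - (x + y) = (s *\<^sub>R u - x) + ((t - s) *\<^sub>R u - y)" by (simp add: algebra_simps)
      also have "\<dots> \<in> P" using s xy by (intro Padd above) auto
      finally show "t *\<^sub>R u - (x + y) \<in> P" .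
    qed
  next
    fix r :: real and x assume x: "x \<in> ?E"
    have rx: "r *\<^sub>R x \<in> ?E" using subspace_order_bounded[OF cone u] x by (rule subspace_scale)
    show "\<phi> (r *\<^sub>R x) = r * \<phi> x"
    proof (cases r "0::real" rule: linorder_cases)
      case less
      have eq: "t *\<^sub>R u - r *\<^sub>R x = (- r) *\<^sub>R (x - (t / r) *\<^sub>R u)"
        "r *\<^sub>R x - t *\<^sub>R u = (- r) *\<^sub>R ((t / r) *\<^sub>R u - x)" for t
        using less by (simp_all add: scaleR_diff_right)
      show ?thesis
      proof (rule \<phi>_eqI[OF rx]; unfold eq; intro Pscale below above x)
        fix t assume "t < r * \<phi> x"
        then show "\<phi> x < t / r" using less by (simp add: field_simps)
      next
        fix t assume "r * \<phi> x < t"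
        then show "t / r < \<phi> x" using less by (simp add: field_simps)
      qed (use less in auto)
    next
      case equal
      then show ?thesis using \<phi>_eqI[OF rx] uP by (auto simp flip: scaleR_minus_left)
    next
      case greater
      have eq: "t *\<^sub>R u - r *\<^sub>R x = r *\<^sub>R ((t / r) *\<^sub>R u - x)"
        "r *\<^sub>R x - t *\<^sub>R u = r *\<^sub>R (x - (t / r) *\<^sub>R u)" for t
        using greater by (simp_all add: scaleR_diff_right)
      show ?thesis
      proof (rule \<phi>_eqI[OF rx]; unfold eq; intro Pscale below above x)
        fix t assume "t < r * \<phi> x"
        then show "t / r < \<phi> x" using greater by (simp add: field_simps)
      next
        fix t assume "r * \<phi> x < t"
        then show "\<phi> x < t / r" using greater by (simp add: field_simps)
      qed (use greater in auto)
    qed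
  qed
qed

section \<open>Completion of a semi-inner product space\<close>

text \<open>
  The type classes for inner products demand definiteness and fix the form with the type. Here
  the form may be degenerate, and it will depend on a functional obtained inside a proof.
\<close>
locale semi_inner_product =
  fixes b :: "'v::real_vector \<Rightarrow> 'v \<Rightarrow> real"
  assumes add_left: "b (x + y) z = b x z + b y z"
    and scaleR_left: "b (r *\<^sub>R x) y = r * b x y"
    and commute: "b x y = b y x"
    and nonneg: "0 \<le> b x x"
begin

lemma add_right: "b z (x + y) = b z x + b z y"
  by (metis add_left commute)

lemma scaleR_right: "b x (r *\<^sub>R y) = r * b x y"
  by (metis scaleR_left commute)

lemma diff_left: "b (x - y) z = b x z - b y z"
  using add_left[of x "- 1 *\<^sub>R y" z] scaleR_left[of "- 1" y z] by simp

lemma diff_right: "b z (x - y) = b z x - b z y"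
  by (metis diff_left commute)

lemma zero_left [simp]: "b 0 z = 0"
  using scaleR_left[of 0 0 z] by simp

lemma zero_right [simp]: "b z 0 = 0"
  by (simp add: commute[of z])

lemma Cauchy_Schwarz: "(b x y)\<^sup>2 \<le> b x x * b y y"
proof -
  have expand: "0 \<le> b x x + 2 * t * b x y + t\<^sup>2 * b y y" for t
    using nonneg[of "x + t *\<^sub>R y"]
    by (simp add: add_left add_right scaleR_left scaleR_right commute[of y x]
        power2_eq_square algebra_simps)
  show ?thesis
  proof (cases "b y y = 0")
    case True
    have "b x y = 0"
    proof (rule ccontr)
      assume "b x y \<noteq> 0"
      then show False
        using expand[of "- (b x x + 1) / (2 * b x y)"] True by (simp add: field_simps)
    qed
    then show ?thesis using True by simp
  next
    case False
    then have "0 < b y y" using nonneg[of y] by simp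
    then show ?thesis
      using expand[of "- b x y / b y y"] by (simp add: field_simps power2_eq_square)
  qed
qed

definition seminorm :: "'v \<Rightarrow> real" where
  "seminorm x = sqrt (b x x)"

lemma seminorm_nonneg [simp]: "0 \<le> seminorm x"
  by (simp add: seminorm_def nonneg)

lemma seminorm_power2: "(seminorm x)\<^sup>2 = b x x"
  by (simp add: seminorm_def nonneg)

lemma abs_le_seminorm: "\<bar>b x y\<bar> \<le> seminorm x * seminorm y"
proof (rule power2_le_imp_le)
  show "\<bar>b x y\<bar>\<^sup>2 \<le> (seminorm x * seminorm y)\<^sup>2"
    using Cauchy_Schwarz[of x y] by (simp add: power_mult_distrib seminorm_power2)
qed simp

lemma form_eq_0: "b x x = 0 \<Longrightarrow> b x y = 0"
  using Cauchy_Schwarz[of x y] by simp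

lemma seminorm_triangle: "seminorm (x + y) \<le> seminorm x + seminorm y"
proof (rule power2_le_imp_le)
  have "(seminorm (x + y))\<^sup>2 = (seminorm x)\<^sup>2 + 2 * b x y + (seminorm y)\<^sup>2"
    by (simp add: seminorm_power2 add_left add_right commute[of y x])
  also have "\<dots> \<le> (seminorm x + seminorm y)\<^sup>2"
    using abs_le_seminorm[of x y] by (simp add: power2_sum)
  finally show "(seminorm (x + y))\<^sup>2 \<le> (seminorm x + seminorm y)\<^sup>2" .
qed simp

lemma seminorm_scaleR: "seminorm (r *\<^sub>R x) = \<bar>r\<bar> * seminorm x"
  by (simp add: seminorm_def scaleR_left scaleR_right real_sqrt_mult flip: mult.assoc)

lemma seminorm_minus_commute: "seminorm (x - y) = seminorm (y - x)"
  using seminorm_scaleR[of "- 1" "x - y"] by simp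

lemma abs_seminorm_diff_le: "\<bar>seminorm x - seminorm y\<bar> \<le> seminorm (x - y)"
  using seminorm_triangle[of "x - y" y] seminorm_triangle[of "y - x" x]
    seminorm_minus_commute[of x y] by simp

definition seminorm_Cauchy :: "(nat \<Rightarrow> 'v) \<Rightarrow> bool" where
  "seminorm_Cauchy X \<longleftrightarrow> (\<forall>e>0. \<exists>M. \<forall>m\<ge>M. \<forall>n\<ge>M. seminorm (X m - X n) < e)"

lemma seminorm_Cauchy_const [simp]: "seminorm_Cauchy (\<lambda>n. x)"
  by (auto simp: seminorm_Cauchy_def seminorm_def)

lemma seminorm_Cauchy_add:
  assumes "seminorm_Cauchy X" "seminorm_Cauchy Y"
  shows "seminorm_Cauchy (\<lambda>n. X n + Y n)"
  unfolding seminorm_Cauchy_def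
proof (intro allI impI)
  fix e :: real assume "0 < e"
  then obtain M N where M: "\<And>m n. m \<ge> M \<Longrightarrow> n \<ge> M \<Longrightarrow> seminorm (X m - X n) < e/2"
    and N: "\<And>m n. m \<ge> N \<Longrightarrow> n \<ge> N \<Longrightarrow> seminorm (Y m - Y n) < e/2"
    using assms unfolding seminorm_Cauchy_def by (meson half_gt_zero)
  show "\<exists>M. \<forall>m\<ge>M. \<forall>n\<ge>M. seminorm (X m + Y m - (X n + Y n)) < e"
  proof (intro exI[of _ "max M N"] allI impI)
    fix m n assume mn: "max M N \<le> m" "max M N \<le> n"
    have "seminorm (X m + Y m - (X n + Y n)) \<le> seminorm (X m - X n) + seminorm (Y m - Y n)"
      using seminorm_triangle[of "X m - X n" "Y m - Y n"] by (simp add: algebra_simps)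
    then show "seminorm (X m + Y m - (X n + Y n)) < e"
      using M[of m n] N[of m n] mn by simp
  qed
qed

lemma seminorm_Cauchy_scaleR:
  assumes "seminorm_Cauchy X"
  shows "seminorm_Cauchy (\<lambda>n. r *\<^sub>R X n)"
  unfolding seminorm_Cauchy_def
proof (intro allI impI)
  fix e :: real assume e: "0 < e"
  then have "0 < e / (\<bar>r\<bar> + 1)" by simp
  then obtain M where M: "\<And>m n. m \<ge> M \<Longrightarrow> n \<ge> M \<Longrightarrow> seminorm (X m - X n) < e / (\<bar>r\<bar> + 1)"
    using assms unfolding seminorm_Cauchy_def by meson
  have "seminorm (r *\<^sub>R X m - r *\<^sub>R X n) < e" if "m \<ge> M" "n \<ge> M" for m n
  proof -
    have "seminorm (r *\<^sub>R X m - r *\<^sub>R X n) = \<bar>r\<bar> * seminorm (X m - X n)"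
      by (metis seminorm_scaleR scaleR_diff_right)
    also have "\<dots> \<le> (\<bar>r\<bar> + 1) * seminorm (X m - X n)" by (simp add: mult_right_mono)
    also have "\<dots> < e" using M[OF that] by (simp add: field_simps)
    finally show ?thesis .
  qed
  then show "\<exists>M. \<forall>m\<ge>M. \<forall>n\<ge>M. seminorm (r *\<^sub>R X m - r *\<^sub>R X n) < e" by blast
qed

lemma seminorm_Cauchy_diff:
  "seminorm_Cauchy X \<Longrightarrow> seminorm_Cauchy Y \<Longrightarrow> seminorm_Cauchy (\<lambda>n. X n - Y n)"
  using seminorm_Cauchy_add[OF _ seminorm_Cauchy_scaleR[of Y "- 1"]] by simp

lemma convergent_seminorm:
  assumes "seminorm_Cauchy X"
  shows "convergent (\<lambda>n. seminorm (X n))"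
proof -
  have "Cauchy (\<lambda>n. seminorm (X n))"
    unfolding Cauchy_def dist_real_def
    by (meson assms abs_seminorm_diff_le le_less_trans seminorm_Cauchy_def)
  then show ?thesis by (rule Cauchy_convergent)
qed

text \<open>
  By polarization the form is a combination of squared seminorms, and these converge along Cauchy
  sequences.
\<close>
lemma convergent_form:
  assumes "seminorm_Cauchy X" "seminorm_Cauchy Y"
  shows "convergent (\<lambda>n. b (X n) (Y n))"
proof -
  have polar: "b x y = ((seminorm (x + y))\<^sup>2 - (seminorm (x - y))\<^sup>2) / 4" for x y
    by (simp add: seminorm_power2 add_left add_right diff_left diff_right commute[of y x])
  obtain l m where "(\<lambda>n. seminorm (X n + Y n)) \<longlonglongrightarrow> l" "(\<lambda>n. seminorm (X n - Y n)) \<longlonglongrightarrow> m"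
    using convergent_seminorm[OF seminorm_Cauchy_add[OF assms]]
      convergent_seminorm[OF seminorm_Cauchy_diff[OF assms]]
    unfolding convergent_def by blast
  then have "(\<lambda>n. ((seminorm (X n + Y n))\<^sup>2 - (seminorm (X n - Y n))\<^sup>2) / 4) \<longlonglongrightarrow> (l\<^sup>2 - m\<^sup>2) / 4"
    by (intro tendsto_intros) simp_all
  then have "(\<lambda>n. b (X n) (Y n)) \<longlonglongrightarrow> (l\<^sup>2 - m\<^sup>2) / 4" by (simp only: polar)
  then show ?thesis by (rule convergentI)
qed

end

text \<open>
  A spanning family turns vectors into functions on its index set, by pairing with the members of
  the family. The completion can therefore be realised inside the function space \<open>'i \<Rightarrow> real\<close>,
  and the same encoding divides out the null vectors of the form.
\<close>
locale spanned_semi_inner_product = semi_inner_product b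
  for b :: "'v::real_vector \<Rightarrow> 'v \<Rightarrow> real" +
  fixes gen :: "'i \<Rightarrow> 'v"
  assumes span_gen: "span (range gen) = UNIV"
begin

definition coords :: "'v \<Rightarrow> 'i \<Rightarrow> real" where
  "coords x = (\<lambda>i. b x (gen i))"

definition represents :: "(nat \<Rightarrow> 'v) \<Rightarrow> ('i \<Rightarrow> real) \<Rightarrow> bool" where
  "represents X f \<longleftrightarrow> seminorm_Cauchy X \<and> (\<forall>i. (\<lambda>n. coords (X n) i) \<longlonglongrightarrow> f i)"

definition completion :: "('i \<Rightarrow> real) set" where
  "completion = {f. \<exists>X. represents X f}"

text \<open>
  The inner product is the limit of the form along Cauchy sequences that represent the two
  functions; \<open>inner_limit\<close> shows that the choice of these sequences does not matter.
\<close>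
definition completion_inner :: "('i \<Rightarrow> real) \<Rightarrow> ('i \<Rightarrow> real) \<Rightarrow> real" where
  "completion_inner f g = lim (\<lambda>n. b ((SOME X. represents X f) n) ((SOME X. represents X g) n))"

lemma representsD: "represents X f \<Longrightarrow> seminorm_Cauchy X"
  by (simp add: represents_def)

lemma represents_coords: "represents (\<lambda>n. x) (coords x)"
  by (simp add: represents_def)

lemma represents_add:
  "represents X f \<Longrightarrow> represents Y g \<Longrightarrow> represents (\<lambda>n. X n + Y n) (f + g)"
  by (auto simp: represents_def coords_def seminorm_Cauchy_add add_left tendsto_add)

lemma represents_scaleR: "represents X f \<Longrightarrow> represents (\<lambda>n. r *\<^sub>R X n) (r *\<^sub>R f)"
  by (auto simp: represents_def coords_def seminorm_Cauchy_scaleR scaleR_left scaleR_fun_def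
      intro!: tendsto_mult_left)

lemma represents_diff:
  "represents X f \<Longrightarrow> represents Y g \<Longrightarrow> represents (\<lambda>n. X n - Y n) (f - g)"
  using represents_add[OF _ represents_scaleR[of Y g "- 1"], of X f]
  by simp

text \<open>
  A function determines its vector: a Cauchy sequence \<open>Z\<close> whose coordinates tend to \<open>0\<close> tends
  to \<open>0\<close> in seminorm. As the family spans, \<open>Z\<close> tends weakly to \<open>0\<close>. With a fixed late index
  \<open>M\<close>, the first summand of \<open>b (Z n) (Z n) = b (Z n) (Z M) + b (Z n) (Z n - Z M)\<close> tends to
  \<open>0\<close> and the second is small by the Cauchy-Schwarz inequality.
\<close>
lemma represents_zero:
  assumes "represents Z 0"
  shows "(\<lambda>n. seminorm (Z n)) \<longlonglongrightarrow> 0"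
proof -
  have weak: "(\<lambda>n. b (Z n) v) \<longlonglongrightarrow> 0" for v
  proof -
    have "v \<in> span (range gen)" by (simp add: span_gen)
    then show ?thesis
    proof (induction rule: span_induct_alt)
      case base
      then show ?case by simp
    next
      case (step r x y)
      have "(\<lambda>n. b (Z n) x) \<longlonglongrightarrow> 0"
        using step(1) assms by (auto simp: represents_def coords_def zero_fun_def)
      then have "(\<lambda>n. r * b (Z n) x + b (Z n) y) \<longlonglongrightarrow> r * 0 + 0"
        by (intro tendsto_intros step)
      then show ?case by (simp add: add_right scaleR_right)
    qed
  qed
  have cau: "seminorm_Cauchy Z" using assms by (rule representsD)
  obtain l where l: "(\<lambda>n. seminorm (Z n)) \<longlonglongrightarrow> l"
    using convergent_seminorm[OF cau] by (auto simp: convergent_def)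
  have "l \<le> e" if e: "0 < e" for e
  proof (cases "l \<le> 0")
    case False
    obtain M where M: "\<And>m n. m \<ge> M \<Longrightarrow> n \<ge> M \<Longrightarrow> seminorm (Z m - Z n) < e"
      using cau e unfolding seminorm_Cauchy_def by meson
    have "(\<lambda>n. (seminorm (Z n))\<^sup>2) \<longlonglongrightarrow> l\<^sup>2" by (intro tendsto_intros l)
    moreover have "(\<lambda>n. b (Z n) (Z M) + seminorm (Z n) * e) \<longlonglongrightarrow> 0 + l * e"
      by (intro tendsto_intros l weak)
    moreover have "(seminorm (Z n))\<^sup>2 \<le> b (Z n) (Z M) + seminorm (Z n) * e" if "n \<ge> M" for n
    proof -
      have "(seminorm (Z n))\<^sup>2 = b (Z n) (Z M) + b (Z n) (Z n - Z M)"
        by (simp add: seminorm_power2 diff_right)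
      also have "b (Z n) (Z n - Z M) \<le> seminorm (Z n) * seminorm (Z n - Z M)"
        using abs_le_seminorm[of "Z n" "Z n - Z M"] by simp
      also have "\<dots> \<le> seminorm (Z n) * e"
        using M[of n M] that by (intro mult_left_mono) auto
      finally show ?thesis by simp
    qed
    ultimately have "l\<^sup>2 \<le> 0 + l * e"
      by (intro LIMSEQ_le[of _ _ _ "0 + l * e"]) blast+
    then show ?thesis using False by (simp add: power2_eq_square)
  qed (use e in simp)
  then have "l \<le> 0" by (rule dense_ge)
  moreover have "0 \<le> l" by (rule LIMSEQ_le_const[OF l]) auto
  ultimately show ?thesis using l by simp
qed

lemma inner_limit:
  assumes f: "represents X f" and g: "represents Y g"
  shows "(\<lambda>n. b (X n) (Y n)) \<longlonglongrightarrow> completion_inner f g"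
proof -
  define X' where "X' = (SOME X. represents X f)"
  define Y' where "Y' = (SOME Y. represents Y g)"
  have f': "represents X' f" and g': "represents Y' g"
    unfolding X'_def Y'_def
    by (rule someI[of "\<lambda>X. represents X f", OF f]) (rule someI[of "\<lambda>Y. represents Y g", OF g])
  have lim': "(\<lambda>n. b (X' n) (Y' n)) \<longlonglongrightarrow> completion_inner f g"
    using convergent_form[OF representsD[OF f'] representsD[OF g']]
    by (simp add: completion_inner_def X'_def Y'_def convergent_LIMSEQ_iff)
  obtain ly where ly: "(\<lambda>n. seminorm (Y n)) \<longlonglongrightarrow> ly"
    using convergent_seminorm[OF representsD[OF g]] by (auto simp: convergent_def)
  obtain lx where lx: "(\<lambda>n. seminorm (X' n)) \<longlonglongrightarrow> lx"
    using convergent_seminorm[OF representsD[OF f']] by (auto simp: convergent_def)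
  have "(\<lambda>n. seminorm (X n - X' n)) \<longlonglongrightarrow> 0" "(\<lambda>n. seminorm (Y n - Y' n)) \<longlonglongrightarrow> 0"
    using represents_diff[OF f f'] represents_diff[OF g g'] by (auto intro: represents_zero)
  then have "(\<lambda>n. seminorm (X n - X' n) * seminorm (Y n) + seminorm (X' n) * seminorm (Y n - Y' n))
      \<longlonglongrightarrow> 0 * ly + lx * 0"
    by (intro tendsto_intros lx ly)
  then have "(\<lambda>n. seminorm (X n - X' n) * seminorm (Y n) + seminorm (X' n) * seminorm (Y n - Y' n))
      \<longlonglongrightarrow> 0"
    by simp
  then have "(\<lambda>n. b (X n) (Y n) - b (X' n) (Y' n)) \<longlonglongrightarrow> 0"
  proof (rule Lim_null_comparison[rotated], intro always_eventually allI)
    fix n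
    have "b (X n) (Y n) - b (X' n) (Y' n) = b (X n - X' n) (Y n) + b (X' n) (Y n - Y' n)"
      by (simp add: diff_left diff_right)
    then show "norm (b (X n) (Y n) - b (X' n) (Y' n))
        \<le> seminorm (X n - X' n) * seminorm (Y n) + seminorm (X' n) * seminorm (Y n - Y' n)"
      using abs_le_seminorm[of "X n - X' n" "Y n"] abs_le_seminorm[of "X' n" "Y n - Y' n"] by simp
  qed
  from tendsto_add[OF this lim'] show ?thesis by simp
qed

lemma inner_eqI:
  "represents X f \<Longrightarrow> represents Y g \<Longrightarrow> (\<lambda>n. b (X n) (Y n)) \<longlonglongrightarrow> l \<Longrightarrow> completion_inner f g = l"
  by (rule LIMSEQ_unique[OF inner_limit])

definition norm_completion :: "('i \<Rightarrow> real) \<Rightarrow> real" where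
  "norm_completion f = sqrt (completion_inner f f)"

lemma norm_completion_limit: "represents X f \<Longrightarrow> (\<lambda>n. seminorm (X n)) \<longlonglongrightarrow> norm_completion f"
  unfolding norm_completion_def seminorm_def by (intro tendsto_real_sqrt inner_limit)

lemma subspace_completion: "subspace completion"
proof (rule subspaceI)
  have "represents (\<lambda>n. 0) 0" by (simp add: represents_def coords_def)
  then show "0 \<in> completion" by (auto simp: completion_def)
next
  show "f + g \<in> completion" if "f \<in> completion" "g \<in> completion" for f g
    using that represents_add unfolding completion_def mem_Collect_eq by meson
  show "r *\<^sub>R f \<in> completion" if "f \<in> completion" for r f
    using that represents_scaleR unfolding completion_def mem_Collect_eq by meson
qed

lemma norm_completion_triangle:
  assumes "f \<in> completion" "g \<in> completion"
  shows "norm_completion (f + g) \<le> norm_completion f + norm_completion g"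
proof -
  obtain X Y where XY: "represents X f" "represents Y g" using assms by (auto simp: completion_def)
  show ?thesis
    by (rule LIMSEQ_le[OF norm_completion_limit[OF represents_add[OF XY]]
          tendsto_add[OF norm_completion_limit[OF XY(1)] norm_completion_limit[OF XY(2)]]])
      (auto simp: seminorm_triangle)
qed

lemma coords_mem: "coords x \<in> completion"
  using represents_coords by (auto simp: completion_def)

lemma coords_diff: "coords x - coords y = coords (x - y)"
  by (simp add: coords_def fun_eq_iff diff_left)

lemma norm_completion_coords: "norm_completion (coords x) = seminorm x"
  using norm_completion_limit[OF represents_coords] by (simp add: LIMSEQ_const_iff)

text \<open>
  The original space is dense in the completion, as the terms of a representing sequence converge
  to the function they represent.
\<close>
lemma coords_dense:
  assumes X: "represents X f" and e: "0 < e"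
  shows "\<exists>M. \<forall>k\<ge>M. norm_completion (f - coords (X k)) < e"
proof -
  obtain M where M: "\<And>m n. m \<ge> M \<Longrightarrow> n \<ge> M \<Longrightarrow> seminorm (X m - X n) < e/2"
    using representsD[OF X] e unfolding seminorm_Cauchy_def by (meson half_gt_zero)
  have "norm_completion (f - coords (X k)) < e" if "k \<ge> M" for k
  proof -
    have "(\<lambda>n. seminorm (X n - X k)) \<longlonglongrightarrow> norm_completion (f - coords (X k))"
      by (rule norm_completion_limit[OF represents_diff[OF X represents_coords]])
    then have "norm_completion (f - coords (X k)) \<le> e/2"
      using M that by (intro LIMSEQ_le_const2) (auto intro: less_imp_le)
    then show ?thesis using e by simp
  qed
  then show ?thesis by blast
qed

lemma norm_completion_minus_commute:
  assumes "f \<in> completion" "g \<in> completion"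
  shows "norm_completion (f - g) = norm_completion (g - f)"
proof -
  obtain X Y where XY: "represents X f" "represents Y g" using assms by (auto simp: completion_def)
  have "(\<lambda>n. seminorm (Y n - X n)) \<longlonglongrightarrow> norm_completion (f - g)"
    using norm_completion_limit[OF represents_diff[OF XY]] by (simp add: seminorm_minus_commute)
  then show ?thesis
    using norm_completion_limit[OF represents_diff[OF XY(2,1)]] by (rule LIMSEQ_unique)
qed

text \<open>
  Each \<open>F n\<close> is within \<open>1/(n+1)\<close> of some vector \<open>u n\<close> of the original space. The sequence
  \<open>u\<close> is then itself Cauchy, and the function that it represents is the limit of \<open>F\<close>.
\<close>
lemma completion_complete:
  assumes F: "\<And>n. F n \<in> completion"
    and cau: "\<forall>e>0. \<exists>M. \<forall>m\<ge>M. \<forall>n\<ge>M. norm_completion (F m - F n) < e"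
  shows "\<exists>f\<in>completion. (\<lambda>n. norm_completion (F n - f)) \<longlonglongrightarrow> 0"
proof -
  note diffH = subspace_diff[OF subspace_completion]
  have "\<exists>x. norm_completion (F n - coords x) < inverse (Suc n)" for n
    using F[of n] coords_dense[of _ "F n" "inverse (Suc n)"] by (force simp: completion_def)
  then obtain u where u: "\<And>n. norm_completion (F n - coords (u n)) < inverse (Suc n)" by metis
  have tri: "norm_completion (f - h) \<le> norm_completion (f - g) + norm_completion (g - h)"
    if "f \<in> completion" "g \<in> completion" "h \<in> completion" for f g h
    using norm_completion_triangle[of "f - g" "g - h"] that diffH by simp
  have approx: "\<exists>M. \<forall>n\<ge>M. norm_completion (F n - coords (u n)) < e" if e: "0 < e" for e
  proof -
    obtain M where "inverse (real (Suc M)) < e" using reals_Archimedean[OF e] by auto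
    moreover have "inverse (real (Suc n)) \<le> inverse (real (Suc M))" if "n \<ge> M" for n
      using that by (simp add: le_imp_inverse_le)
    ultimately show ?thesis using u by (meson le_less_trans less_trans less_le_trans)
  qed
  have "seminorm_Cauchy u"
    unfolding seminorm_Cauchy_def
  proof (intro allI impI)
    fix e :: real assume "0 < e"
    then have e3: "0 < e/3" by simp
    obtain M where M: "\<And>m n. m \<ge> M \<Longrightarrow> n \<ge> M \<Longrightarrow> norm_completion (F m - F n) < e/3"
      using cau e3 by meson
    obtain N where N: "\<And>n. n \<ge> N \<Longrightarrow> norm_completion (F n - coords (u n)) < e/3"
      using approx[OF e3] by blast
    show "\<exists>M. \<forall>m\<ge>M. \<forall>n\<ge>M. seminorm (u m - u n) < e"
    proof (intro exI[of _ "max M N"] allI impI)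
      fix m n assume mn: "max M N \<le> m" "max M N \<le> n"
      have "seminorm (u m - u n) = norm_completion (coords (u m) - coords (u n))"
        by (simp add: coords_diff norm_completion_coords)
      also have "\<dots> \<le> norm_completion (coords (u m) - F m)
          + (norm_completion (F m - F n) + norm_completion (F n - coords (u n)))"
        using tri[of "coords (u m)" "F m" "coords (u n)"] tri[of "F m" "F n" "coords (u n)"]
        by (simp add: F coords_mem)
      also have "\<dots> < e"
        using M[of m n] N[of m] N[of n] mn
          norm_completion_minus_commute[OF F coords_mem, of m "u m"] by simp
      finally show "seminorm (u m - u n) < e" .
    qed
  qed
  define f where "f i = lim (\<lambda>n. coords (u n) i)" for i
  have rep: "represents u f"
    using \<open>seminorm_Cauchy u\<close> convergent_form[OF _ seminorm_Cauchy_const]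
    by (simp add: represents_def f_def coords_def convergent_LIMSEQ_iff)
  then have fH: "f \<in> completion" by (auto simp: completion_def)
  have "(\<lambda>n. norm_completion (F n - f)) \<longlonglongrightarrow> 0"
  proof (rule LIMSEQ_I)
    fix e :: real assume "0 < e"
    then have e2: "0 < e/2" by simp
    obtain M where M: "\<And>n. n \<ge> M \<Longrightarrow> norm_completion (f - coords (u n)) < e/2"
      using coords_dense[OF rep e2] by blast
    obtain N where N: "\<And>n. n \<ge> N \<Longrightarrow> norm_completion (F n - coords (u n)) < e/2"
      using approx[OF e2] by blast
    have "norm (norm_completion (F n - f) - 0) < e" if "n \<ge> max M N" for n
    proof -
      have "norm_completion (F n - f) \<le> norm_completion (F n - coords (u n)) + norm_completion (coords (u n) - f)"
        by (intro tri F coords_mem fH)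
      moreover have "0 \<le> norm_completion (F n - f)"
      proof -
        obtain X where X: "represents X (F n - f)" using diffH[OF F fH] by (auto simp: completion_def)
        show ?thesis by (rule LIMSEQ_le_const[OF norm_completion_limit[OF X]]) auto
      qed
      ultimately show ?thesis
        using M[of n] N[of n] that norm_completion_minus_commute[OF fH coords_mem, of "u n"] by simp
    qed
    then show "\<exists>no. \<forall>n\<ge>no. norm (norm_completion (F n - f) - 0) < e" by blast
  qed
  then show ?thesis using fH by blast
qed

theorem real_hilbert_space: "real_hilbert_space completion completion_inner"
proof
  show "subspace completion" by (rule subspace_completion)
next
  fix f g assume "f \<in> completion" "g \<in> completion"
  then obtain X Y where XY: "represents X f" "represents Y g" by (auto simp: completion_def)
  show "completion_inner f g = completion_inner g f"
    by (rule inner_eqI[OF XY]) (subst commute, rule inner_limit[OF XY(2,1)])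
  show "completion_inner (r *\<^sub>R f) g = r * completion_inner f g" for r
    by (rule inner_eqI[OF represents_scaleR[OF XY(1)] XY(2)])
      (simp add: scaleR_left tendsto_mult_left inner_limit[OF XY])
  fix h assume "h \<in> completion"
  then obtain Z where Z: "represents Z h" by (auto simp: completion_def)
  show "completion_inner (f + g) h = completion_inner f h + completion_inner g h"
    by (rule inner_eqI[OF represents_add[OF XY] Z])
      (simp add: add_left tendsto_add inner_limit[OF XY(1) Z] inner_limit[OF XY(2) Z])
next
  fix f assume "f \<in> completion"
  then obtain X where X: "represents X f" by (auto simp: completion_def)
  show "0 \<le> completion_inner f f" by (rule LIMSEQ_le_const[OF inner_limit[OF X X]]) (auto simp: nonneg)
  assume "completion_inner f f = 0"
  then have q0: "(\<lambda>n. seminorm (X n)) \<longlonglongrightarrow> 0" using norm_completion_limit[OF X] by (simp add: norm_completion_def)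
  show "f = 0"
  proof
    fix i
    have "(\<lambda>n. seminorm (X n) * seminorm (gen i)) \<longlonglongrightarrow> 0"
      using tendsto_mult_left_zero[OF q0] .
    then have "(\<lambda>n. coords (X n) i) \<longlonglongrightarrow> 0"
      by (rule Lim_null_comparison[rotated]) (simp add: coords_def abs_le_seminorm)
    moreover have "(\<lambda>n. coords (X n) i) \<longlonglongrightarrow> f i" using X by (simp add: represents_def)
    ultimately show "f i = 0 i" by (simp add: LIMSEQ_unique)
  qed
next
  fix F assume "\<And>n::nat. F n \<in> completion"
    and "\<forall>e>0. \<exists>M. \<forall>m\<ge>M. \<forall>n\<ge>M. sqrt (completion_inner (F m - F n) (F m - F n)) < e"
  then show "\<exists>f\<in>completion. (\<lambda>n. sqrt (completion_inner (F n - f) (F n - f))) \<longlonglongrightarrow> 0"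
    using completion_complete by (simp add: norm_completion_def)
qed

end

section \<open>The real group algebra\<close>

lemma poly_mapping_additive_induct [case_names single add]:
  fixes a :: "'i \<Rightarrow>\<^sub>0 'r::comm_monoid_add"
  assumes single: "\<And>k r. P (Poly_Mapping.single k r)"
    and add: "\<And>a b. P a \<Longrightarrow> P b \<Longrightarrow> P (a + b)"
  shows "P a"
proof (induction a rule: Poly_Mapping.update_induct)
  case const
  then show ?case using single[of undefined 0] by simp
next
  case (update f k v)
  have "Poly_Mapping.update k v f = f + Poly_Mapping.single k v"
    using update.hyps(1)
    by (intro poly_mapping_eqI)
      (auto simp: lookup_update lookup_add lookup_single in_keys_iff when_def)
  then show ?case using add[OF update.IH single] by simp
qed

lemma lookup_scaleR [simp]: "Poly_Mapping.lookup (r *\<^sub>R a) g = r *\<^sub>R Poly_Mapping.lookup a g"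
proof -
  have "finite {i. r *\<^sub>R Poly_Mapping.lookup a i \<noteq> 0}"
    by (rule finite_subset[OF _ finite_lookup[of a]]) auto
  then show ?thesis by (simp add: scaleR_poly_mapping_def)
qed

lemma scaleR_single: "r *\<^sub>R Poly_Mapping.single g x = Poly_Mapping.single g (r *\<^sub>R x)"
  by (rule poly_mapping_eqI) (simp add: lookup_single when_def)

lemma scaleR_conv_mult: "r *\<^sub>R a = Poly_Mapping.single 0 r * a"
  for a :: "'g::monoid_add \<Rightarrow>\<^sub>0 real"
  by (induction a rule: poly_mapping_additive_induct)
    (simp_all add: scaleR_single mult_single scaleR_add_right distrib_left)

lemma mult_single_commute: "a * Poly_Mapping.single 0 r = Poly_Mapping.single 0 r * a"
  for a :: "'g::monoid_add \<Rightarrow>\<^sub>0 real"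
  by (induction a rule: poly_mapping_additive_induct)
    (simp_all add: mult_single distrib_left distrib_right mult.commute)

lemma scaleR_mult_left: "(r *\<^sub>R a) * b = r *\<^sub>R (a * b)"
  for a b :: "'g::monoid_add \<Rightarrow>\<^sub>0 real"
  by (simp add: scaleR_conv_mult mult.assoc)

lemma scaleR_mult_right: "a * (r *\<^sub>R b) = r *\<^sub>R (a * b)"
  for a b :: "'g::monoid_add \<Rightarrow>\<^sub>0 real"
  by (metis mult.assoc mult_single_commute scaleR_conv_mult)

lemma lookup_star [simp]: "Poly_Mapping.lookup (star a) g = Poly_Mapping.lookup a (- g)"
proof -
  have "Poly_Mapping.lookup (star a) g
      = (\<Sum>h\<in>Poly_Mapping.keys a. if h = - g then Poly_Mapping.lookup a h else 0)"
    unfolding star_def lookup_sum by (rule sum.cong) (auto simp: lookup_single when_def)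
  then show ?thesis by (simp add: in_keys_iff)
qed

lemma star_add [simp]: "star (a + b) = star a + star b"
  by (rule poly_mapping_eqI) (simp add: lookup_add)

lemma star_diff [simp]: "star (a - b) = star a - star b"
  by (rule poly_mapping_eqI) (simp add: lookup_minus)

lemma star_scaleR [simp]: "star (r *\<^sub>R a) = r *\<^sub>R star a"
  by (rule poly_mapping_eqI) simp

lemma star_single [simp]: "star (Poly_Mapping.single g r) = Poly_Mapping.single (- g) r"
  by (rule poly_mapping_eqI) (auto simp: lookup_single when_def)

lemma star_one [simp]: "star 1 = 1"
  using star_single[of 0 1] by simp

lemma star_sum: "star (\<Sum>i\<in>A. f i) = (\<Sum>i\<in>A. star (f i))"
  by (rule poly_mapping_eqI) (simp add: lookup_sum)

lemma star_mult [simp]: "star (a * b) = star b * star a"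
proof (induction a rule: poly_mapping_additive_induct)
  case (single g r)
  show ?case
    by (induction b rule: poly_mapping_additive_induct)
      (simp_all add: mult_single minus_add distrib_left distrib_right mult.commute)
qed (simp add: distrib_left distrib_right)

definition augmentation :: "('g::group_add \<Rightarrow>\<^sub>0 real) \<Rightarrow> real" where
  "augmentation a = (\<Sum>g\<in>Poly_Mapping.keys a. Poly_Mapping.lookup a g)"

lemma mem_augmentation_ideal: "a \<in> augmentation_ideal \<longleftrightarrow> augmentation a = 0"
  by (simp add: augmentation_ideal_def augmentation_def)

lemma augmentation_zero [simp]: "augmentation 0 = 0"
  by (simp add: augmentation_def)

lemma augmentation_add [simp]: "augmentation (a + b) = augmentation a + augmentation b"
  unfolding augmentation_def by (rule setsum_keys_plus_distrib) auto

lemma augmentation_single [simp]: "augmentation (Poly_Mapping.single g r) = r"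
  by (simp add: augmentation_def)

lemma augmentation_one [simp]: "augmentation 1 = 1"
  using augmentation_single[of 0 1] by simp

lemma augmentation_scaleR [simp]: "augmentation (r *\<^sub>R a) = r * augmentation a"
  by (induction a rule: poly_mapping_additive_induct)
    (simp_all add: scaleR_single scaleR_add_right distrib_left)

lemma augmentation_diff [simp]: "augmentation (a - b) = augmentation a - augmentation b"
  by (metis augmentation_add diff_add_cancel eq_diff_eq)

lemma augmentation_sum: "augmentation (\<Sum>i\<in>A. f i) = (\<Sum>i\<in>A. augmentation (f i))"
  by (induction A rule: infinite_finite_induct) simp_all

lemma augmentation_mult [simp]: "augmentation (a * b) = augmentation a * augmentation b"
proof (induction a rule: poly_mapping_additive_induct)
  case (single g r)
  show ?case
    by (induction b rule: poly_mapping_additive_induct) (simp_all add: mult_single distrib_left)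
qed (simp add: distrib_right)

section \<open>Cocycles from isometric group actions\<close>

lemma (in spanned_semi_inner_product) coords_sum: "(\<Sum>i\<in>A. coords (x i)) = coords (\<Sum>i\<in>A. x i)"
proof (induction A rule: infinite_finite_induct)
  case (insert a A)
  then show ?case by (simp add: coords_def add_left fun_eq_iff)
qed (simp_all add: coords_def fun_eq_iff)

text \<open>
  \<open>gen g\<close> stands for the value of the cocycle at \<open>g\<close>, so the hypothesis on \<open>T g (gen h)\<close> is
  the cocycle identity. Together with invariance of the form it gives
  \<open>\<langle>T g x, gen h\<rangle> = \<langle>x, gen (- g + h)\<rangle> - \<langle>x, gen (- g)\<rangle>\<close>. The right-hand side only involves
  the coordinates of \<open>x\<close>, and hence defines the representation on all of the completion, where
  \<open>T\<close> itself does not act. The maps \<open>T g\<close> satisfy the laws of an action only modulo null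
  vectors in the application; on coordinates the laws are identities.
\<close>
lemma one_cocycle_coords:
  fixes b :: "'v::real_vector \<Rightarrow> 'v \<Rightarrow> real" and gen :: "'g::group_add \<Rightarrow> 'v"
    and T :: "'g \<Rightarrow> 'v \<Rightarrow> 'v"
  assumes "spanned_semi_inner_product b gen"
    and T_form: "\<And>g x y. b (T g x) (T g y) = b x y"
    and T_diff: "\<And>g x y. T g (x - y) = T g x - T g y"
    and T_gen: "\<And>g h. T g (gen h) = gen (g + h) - gen g"
    and gen_0: "\<And>x. b x (gen 0) = 0"
  shows "one_cocycle (spanned_semi_inner_product.completion b gen)
    (spanned_semi_inner_product.completion_inner b gen)
    (\<lambda>g f h. f (- g + h) - f (- g)) (\<lambda>g. spanned_semi_inner_product.coords b gen (gen g))"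
proof -
  interpret spanned_semi_inner_product b gen by fact
  have coords_T: "coords (T g x) h = coords x (- g + h) - coords x (- g)" for g x h
  proof -
    have "coords x (- g + h) - coords x (- g)
        = b (T g x) (T g (gen (- g + h))) - b (T g x) (T g (gen (- g)))"
      by (simp add: coords_def T_form)
    also have "\<dots> = b (T g x) (gen h)"
      by (simp add: T_gen diff_right gen_0 flip: add.assoc)
    finally show ?thesis by (simp add: coords_def)
  qed
  have seminorm_T: "seminorm (T g x - T g y) = seminorm (x - y)" for g x y
    by (metis T_diff T_form seminorm_def)
  have rep_T: "represents (\<lambda>n. T g (X n)) (\<lambda>h. f (- g + h) - f (- g))" if "represents X f" for g X f
    using that by (auto simp: represents_def coords_T seminorm_Cauchy_def seminorm_T intro!: tendsto_diff)
  have "one_cocycle_axioms completion (\<lambda>g f h. f (- g + h) - f (- g)) (\<lambda>g. coords (gen g))"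
  proof
    show "coords (gen g) \<in> completion" for g by (rule coords_mem)
    show "coords (gen 0) = 0" by (simp add: coords_def fun_eq_iff commute[of "gen 0"] gen_0)
    show "coords (gen (g + h)) = coords (gen g) + (\<lambda>k. coords (gen h) (- g + k) - coords (gen h) (- g))"
      for g h
    proof
      fix k
      have "coords (gen h) (- g + k) - coords (gen h) (- g) = coords (gen (g + h) - gen g) k"
        by (simp add: T_gen flip: coords_T)
      then show "coords (gen (g + h)) k
          = (coords (gen g) + (\<lambda>k. coords (gen h) (- g + k) - coords (gen h) (- g))) k"
        by (simp add: coords_def diff_left)
    qed
  qed
  moreover have "orthogonal_representation_axioms completion completion_inner (\<lambda>g f h. f (- g + h) - f (- g))"
  proof
    fix f g assume "f \<in> completion"
    then obtain X where X: "represents X f" by (auto simp: completion_def)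
    then show "(\<lambda>h. f (- g + h) - f (- g)) \<in> completion" using rep_T by (auto simp: completion_def)
    have "(\<lambda>n. coords (X n) 0) \<longlonglongrightarrow> f 0" using X by (simp add: represents_def)
    then have "f 0 = 0" by (simp add: coords_def gen_0 LIMSEQ_const_iff)
    then show "(\<lambda>h. f (- 0 + h) - f (- 0)) = f" by simp
    fix f' assume "f' \<in> completion"
    then obtain X' where X': "represents X' f'" by (auto simp: completion_def)
    show "completion_inner (\<lambda>h. f (- g + h) - f (- g)) (\<lambda>h. f' (- g + h) - f' (- g)) = completion_inner f f'"
      by (rule inner_eqI[OF rep_T[OF X] rep_T[OF X']]) (simp add: T_form inner_limit[OF X X'])
  qed (auto simp: fun_eq_iff scaleR_fun_def right_diff_distrib minus_add add.assoc
      simp del: add_uminus_conv_diff)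
  ultimately show ?thesis
    using real_hilbert_space by (simp add: one_cocycle_def orthogonal_representation_def)
qed

section \<open>Sums of squares and the Laplacian as an order unit\<close>

inductive_set sums_of_squares :: "('g::group_add \<Rightarrow>\<^sub>0 real) set" where
  zero: "0 \<in> sums_of_squares"
| add: "a \<in> sums_of_squares \<Longrightarrow> w \<in> augmentation_ideal \<Longrightarrow> a + star w * w \<in> sums_of_squares"

lemma sums_of_squares_square: "w \<in> augmentation_ideal \<Longrightarrow> star w * w \<in> sums_of_squares"
  using sums_of_squares.add[OF sums_of_squares.zero] by simp

lemma sums_of_squares_add:
  assumes "a \<in> sums_of_squares" "b \<in> sums_of_squares"
  shows "a + b \<in> sums_of_squares"
  using assms(2)
proof induction
  case (add c w)
  then show ?case using sums_of_squares.add[of "a + c" w] by (simp add: add.assoc)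
qed (simp add: assms(1))

lemma sums_of_squares_scaleR:
  assumes "a \<in> sums_of_squares" "0 \<le> r"
  shows "r *\<^sub>R a \<in> sums_of_squares"
  using assms(1)
proof induction
  case zero
  then show ?case by (simp add: sums_of_squares.zero)
next
  case (add a w)
  have "r *\<^sub>R (a + star w * w) = r *\<^sub>R a + star (sqrt r *\<^sub>R w) * (sqrt r *\<^sub>R w)"
    using \<open>0 \<le> r\<close> by (simp add: scaleR_mult_left scaleR_mult_right scaleR_add_right)
  moreover have "sqrt r *\<^sub>R w \<in> augmentation_ideal"
    using add.hyps(2) by (simp add: mem_augmentation_ideal)
  ultimately show ?case using sums_of_squares.add[OF add.IH] by metis
qed

lemma convex_cone_sums_of_squares: "convex_cone sums_of_squares"
  by (simp add: convex_cone_iff sums_of_squares.zero sums_of_squares_add sums_of_squares_scaleR)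

lemma sums_of_squares_sum:
  "(\<And>i. i \<in> A \<Longrightarrow> f i \<in> sums_of_squares) \<Longrightarrow> (\<Sum>i\<in>A. f i) \<in> sums_of_squares"
  by (induction A rule: infinite_finite_induct)
    (simp_all add: sums_of_squares.zero sums_of_squares_add)

lemma sums_of_squares_sequence:
  assumes "a \<in> sums_of_squares"
  shows "\<exists>(n::nat) \<omega>. (\<forall>i\<in>{1..n}. \<omega> i \<in> augmentation_ideal) \<and> a = (\<Sum>i=1..n. star (\<omega> i) * \<omega> i)"
  using assms
proof induction
  case zero
  then show ?case by (intro exI[of _ 0]) simp
next
  case (add a w)
  then obtain n :: nat and \<omega> where \<omega>: "\<forall>i\<in>{1..n}. \<omega> i \<in> augmentation_ideal"
    "a = (\<Sum>i=1..n. star (\<omega> i) * \<omega> i)" by blast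
  define \<omega>' where "\<omega>' i = (if i = Suc n then w else \<omega> i)" for i
  have "\<forall>i\<in>{1..Suc n}. \<omega>' i \<in> augmentation_ideal"
    using \<omega>(1) add.hyps(2) by (auto simp: \<omega>'_def)
  moreover have "a + star w * w = (\<Sum>i=1..Suc n. star (\<omega>' i) * \<omega>' i)"
    unfolding \<omega>(2) by (simp add: \<omega>'_def)
  ultimately show ?case by blast
qed

lemma augmentation_ideal_add:
  "v \<in> augmentation_ideal \<Longrightarrow> w \<in> augmentation_ideal \<Longrightarrow> v + w \<in> augmentation_ideal"
  by (simp add: mem_augmentation_ideal)

lemma augmentation_ideal_diff:
  "v \<in> augmentation_ideal \<Longrightarrow> w \<in> augmentation_ideal \<Longrightarrow> v - w \<in> augmentation_ideal"
  by (simp add: mem_augmentation_ideal)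

text \<open>
  The linear projection onto the augmentation ideal along the scalars. It sends a group element
  \<open>g\<close> to \<open>g - 1\<close>, so that forms on the ideal become forms on the whole group algebra, which is
  spanned by \<open>\<Gamma>\<close>.
\<close>
definition aug_proj :: "('g::group_add \<Rightarrow>\<^sub>0 real) \<Rightarrow> ('g \<Rightarrow>\<^sub>0 real)" where
  "aug_proj a = a - augmentation a *\<^sub>R 1"

lemma aug_proj_mem: "aug_proj a \<in> augmentation_ideal"
  by (simp add: aug_proj_def mem_augmentation_ideal)

lemma aug_proj_eq: "w \<in> augmentation_ideal \<Longrightarrow> aug_proj w = w"
  by (simp add: aug_proj_def mem_augmentation_ideal)

lemma aug_proj_add: "aug_proj (a + b) = aug_proj a + aug_proj b"
  by (simp add: aug_proj_def scaleR_add_left)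

lemma aug_proj_diff: "aug_proj (a - b) = aug_proj a - aug_proj b"
  by (simp add: aug_proj_def scaleR_diff_left)

lemma aug_proj_scaleR: "aug_proj (r *\<^sub>R a) = r *\<^sub>R aug_proj a"
  by (simp add: aug_proj_def scaleR_diff_right)

lemma aug_proj_single: "aug_proj (Poly_Mapping.single g r) = r *\<^sub>R (Poly_Mapping.single g 1 - 1)"
  by (simp add: aug_proj_def scaleR_diff_right scaleR_single)

text \<open>
  Each summand is \<open>(s\<^sup>-\<^sup>1 - 1)(s - 1) = 2 - s - s\<^sup>-\<^sup>1\<close>, and symmetry of \<open>S\<close> makes the sums of
  \<open>s\<close> and of \<open>s\<^sup>-\<^sup>1\<close> equal.
\<close>
lemma twice_laplacian:
  assumes "finite S" "uminus ` S = S"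
  shows "2 *\<^sub>R laplacian S
    = (\<Sum>s\<in>S. star (Poly_Mapping.single s 1 - 1) * (Poly_Mapping.single s 1 - 1))"
proof -
  have "(\<Sum>s\<in>S. star (Poly_Mapping.single s 1 - 1) * (Poly_Mapping.single s 1 - (1 :: 'a \<Rightarrow>\<^sub>0 real)))
      = (\<Sum>s\<in>S. 2 *\<^sub>R 1 - Poly_Mapping.single s 1 - Poly_Mapping.single (- s) 1)"
    by (rule sum.cong) (simp_all add: algebra_simps mult_single scaleR_2)
  also have "\<dots> = real (card S) *\<^sub>R 2 *\<^sub>R 1 - (\<Sum>s\<in>S. Poly_Mapping.single s 1)
      - (\<Sum>s\<in>S. Poly_Mapping.single (- s) 1)"
    by (simp add: sum_subtractf sum_constant_scaleR del: sum_constant scaleR_scaleR)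
  also have "(\<Sum>s\<in>S. Poly_Mapping.single (- s) 1) = (\<Sum>s\<in>S. Poly_Mapping.single s (1::real))"
    using sum.reindex[of uminus S "\<lambda>s. Poly_Mapping.single s (1::real)"] assms(2) by simp
  finally show ?thesis
    by (simp add: laplacian_def scaleR_diff_right mult.commute
        scaleR_2[of "\<Sum>s\<in>S. Poly_Mapping.single s 1"])
qed

lemma laplacian_mem: "laplacian S \<in> augmentation_ideal"
  by (simp add: mem_augmentation_ideal laplacian_def augmentation_sum)

lemma star_laplacian:
  assumes "uminus ` S = S"
  shows "star (laplacian S) = laplacian S"
  using sum.reindex[of uminus S "\<lambda>s. Poly_Mapping.single s (1::real)"] assms
  by (simp add: laplacian_def star_sum)

lemma single_minus_one_mem: "Poly_Mapping.single g 1 - 1 \<in> augmentation_ideal"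
  by (simp add: mem_augmentation_ideal)

lemma laplacian_sums_of_squares:
  assumes "finite S" "uminus ` S = S"
  shows "laplacian S \<in> sums_of_squares"
proof -
  have "(\<Sum>s\<in>S. star (Poly_Mapping.single s 1 - 1) * (Poly_Mapping.single s 1 - 1)) \<in> sums_of_squares"
    by (intro sums_of_squares_sum sums_of_squares_square single_minus_one_mem)
  from sums_of_squares_scaleR[OF this, of "1/2"] show ?thesis
    unfolding twice_laplacian[OF assms, symmetric] by simp
qed

definition laplacian_dominated :: "'g::group_add set \<Rightarrow> ('g \<Rightarrow>\<^sub>0 real) set" where
  "laplacian_dominated S = {w \<in> augmentation_ideal. \<exists>t. t *\<^sub>R laplacian S - star w * w \<in> sums_of_squares}"

lemma laplacian_dominated_scaleR:
  assumes "w \<in> laplacian_dominated S"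
  shows "r *\<^sub>R w \<in> laplacian_dominated S"
proof -
  obtain t where t: "t *\<^sub>R laplacian S - star w * w \<in> sums_of_squares" "w \<in> augmentation_ideal"
    using assms by (auto simp: laplacian_dominated_def)
  have "(r\<^sup>2 * t) *\<^sub>R laplacian S - star (r *\<^sub>R w) * (r *\<^sub>R w)
      = r\<^sup>2 *\<^sub>R (t *\<^sub>R laplacian S - star w * w)"
    by (simp add: scaleR_mult_left scaleR_mult_right scaleR_diff_right power2_eq_square)
  also have "\<dots> \<in> sums_of_squares" by (rule sums_of_squares_scaleR[OF t(1)]) simp
  finally show ?thesis using t(2) unfolding laplacian_dominated_def by (auto simp: mem_augmentation_ideal)
qed

text \<open>
  The parallelogram law \<open>|v + w|\<^sup>2 + |v - w|\<^sup>2 = 2|v|\<^sup>2 + 2|w|\<^sup>2\<close>, with \<open>|w|\<^sup>2 = w\<^sup>* w\<close>.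
\<close>
lemma laplacian_dominated_add:
  assumes "v \<in> laplacian_dominated S" "w \<in> laplacian_dominated S"
  shows "v + w \<in> laplacian_dominated S"
proof -
  obtain s t where st: "s *\<^sub>R laplacian S - star v * v \<in> sums_of_squares" "v \<in> augmentation_ideal"
    "t *\<^sub>R laplacian S - star w * w \<in> sums_of_squares" "w \<in> augmentation_ideal"
    using assms by (auto simp: laplacian_dominated_def)
  have "((s + t) + (s + t)) *\<^sub>R laplacian S - star (v + w) * (v + w)
      = 2 *\<^sub>R ((s *\<^sub>R laplacian S - star v * v) + (t *\<^sub>R laplacian S - star w * w))
        + star (v - w) * (v - w)"
    unfolding scaleR_2 scaleR_add_left by (simp add: algebra_simps)
  also have "\<dots> \<in> sums_of_squares"
    using st by (intro sums_of_squares_add sums_of_squares_scaleR sums_of_squares_square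
        augmentation_ideal_diff) auto
  finally show ?thesis
    using st(2,4) unfolding laplacian_dominated_def by (auto simp: augmentation_ideal_add)
qed

lemma laplacian_dominated_translate:
  assumes "w \<in> laplacian_dominated S"
  shows "Poly_Mapping.single g 1 * w \<in> laplacian_dominated S"
proof -
  have "star (Poly_Mapping.single g 1 * w) * (Poly_Mapping.single g 1 * w) = star w * w"
    by (simp add: mult.assoc) (simp add: mult_single flip: mult.assoc)
  then show ?thesis using assms by (simp add: laplacian_dominated_def mem_augmentation_ideal)
qed

text \<open>
  For \<open>s \<in> S\<close> the remaining summands of \<open>2\<Delta>\<close> form a sum of squares. Inverses and products
  are handled by \<open>g\<^sup>-\<^sup>1 - 1 = - g\<^sup>-\<^sup>1 (g - 1)\<close> and \<open>gh - 1 = (g - 1) + g(h - 1)\<close>.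
\<close>
lemma laplacian_dominated_generated_subgroup:
  assumes "finite S" "uminus ` S = S" and g: "g \<in> generated_subgroup S"
  shows "Poly_Mapping.single g 1 - 1 \<in> laplacian_dominated S"
  using g
proof induction
  case zero
  show ?case
    by (auto simp: laplacian_dominated_def mem_augmentation_ideal sums_of_squares.zero intro!: exI[of _ 0])
next
  case (incl s)
  have "2 *\<^sub>R laplacian S - star (Poly_Mapping.single s 1 - 1) * (Poly_Mapping.single s 1 - 1)
      = (\<Sum>r\<in>S - {s}. star (Poly_Mapping.single r 1 - 1) * (Poly_Mapping.single r 1 - 1))"
    unfolding twice_laplacian[OF assms(1,2)] using assms(1) incl by (simp add: sum.remove)
  also have "\<dots> \<in> sums_of_squares"
    by (intro sums_of_squares_sum sums_of_squares_square single_minus_one_mem)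
  finally show ?case unfolding laplacian_dominated_def using single_minus_one_mem by blast
next
  case (minus g)
  have "Poly_Mapping.single (- g) 1 - 1
      = (- 1) *\<^sub>R (Poly_Mapping.single (- g) 1 * (Poly_Mapping.single g 1 - (1 :: 'a \<Rightarrow>\<^sub>0 real)))"
    by (simp add: algebra_simps mult_single)
  then show ?case using laplacian_dominated_scaleR[OF laplacian_dominated_translate[OF minus.IH]] by metis
next
  case (plus g h)
  have "Poly_Mapping.single (g + h) 1 - 1
      = (Poly_Mapping.single g 1 - 1)
        + Poly_Mapping.single g 1 * (Poly_Mapping.single h 1 - (1 :: 'a \<Rightarrow>\<^sub>0 real))"
    by (simp add: algebra_simps mult_single)
  then show ?case using laplacian_dominated_add[OF plus.IH(1) laplacian_dominated_translate[OF plus.IH(2)]] by metis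
qed

lemma laplacian_dominated_eq_augmentation_ideal:
  assumes "finite S" "uminus ` S = S" "generated_subgroup S = UNIV"
  shows "laplacian_dominated S = augmentation_ideal"
proof
  have "aug_proj a \<in> laplacian_dominated S" for a
  proof (induction a rule: poly_mapping_additive_induct)
    case (single g r)
    show ?case unfolding aug_proj_single
      by (intro laplacian_dominated_scaleR laplacian_dominated_generated_subgroup) (simp_all add: assms)
  qed (simp add: aug_proj_add laplacian_dominated_add)
  then show "augmentation_ideal \<subseteq> laplacian_dominated S" using aug_proj_eq by (metis subsetI)
qed (auto simp: laplacian_dominated_def)

lemma square_order_bounded:
  assumes S: "finite S" "uminus ` S = S" "generated_subgroup S = UNIV"
    and w: "w \<in> augmentation_ideal"
  shows "star w * w \<in> order_bounded sums_of_squares (laplacian S)"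
proof -
  obtain t where t: "t *\<^sub>R laplacian S - star w * w \<in> sums_of_squares"
    using w unfolding laplacian_dominated_eq_augmentation_ideal[OF S, symmetric] by (auto simp: laplacian_dominated_def)
  note L = laplacian_sums_of_squares[OF S(1,2)]
  have "\<bar>t\<bar> *\<^sub>R laplacian S - star w * w
      = (t *\<^sub>R laplacian S - star w * w) + (\<bar>t\<bar> - t) *\<^sub>R laplacian S"
    by (simp add: algebra_simps)
  also have "\<dots> \<in> sums_of_squares"
    by (intro sums_of_squares_add t sums_of_squares_scaleR L) simp
  finally have "\<bar>t\<bar> *\<^sub>R laplacian S - star w * w \<in> sums_of_squares" .
  moreover have "\<bar>t\<bar> *\<^sub>R laplacian S + star w * w \<in> sums_of_squares"
    by (intro sums_of_squares_add sums_of_squares_scaleR sums_of_squares_square L w) simp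
  ultimately show ?thesis unfolding order_bounded_def by blast
qed

text \<open>
  By polarization: \<open>v\<^sup>* w + w\<^sup>* v = |v + w|\<^sup>2 - |v|\<^sup>2 - |w|\<^sup>2\<close>.
\<close>
lemma symmetric_product_order_bounded:
  assumes S: "finite S" "uminus ` S = S" "generated_subgroup S = UNIV"
    and vw: "v \<in> augmentation_ideal" "w \<in> augmentation_ideal"
  shows "star v * w + star w * v \<in> order_bounded sums_of_squares (laplacian S)"
proof -
  note sub = subspace_order_bounded[OF convex_cone_sums_of_squares laplacian_sums_of_squares[OF S(1,2)]]
  have "star v * w + star w * v = star (v + w) * (v + w) - star v * v - star w * w"
    by (simp add: algebra_simps)
  also have "\<dots> \<in> order_bounded sums_of_squares (laplacian S)"
    by (intro subspace_diff[OF sub] square_order_bounded[OF S] augmentation_ideal_add vw)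
  finally show ?thesis .
qed

section \<open>The cocycle of a state and the dichotomy\<close>

text \<open>
  The Gelfand-Naimark-Segal construction for \<open>\<phi>\<close> on the augmentation ideal. A product
  \<open>v\<^sup>* w\<close> is in general not hermitian and need not be order bounded, so the form
  applies \<open>\<phi>\<close> to its symmetrisation; invariance under left multiplication by \<open>g\<close> is immediate
  from \<open>g\<^sup>* g = 1\<close>.
\<close>
lemma harmonic_cocycle_of_state:
  fixes S :: "'g::group_add set" and \<phi> :: "('g \<Rightarrow>\<^sub>0 real) \<Rightarrow> real"
  assumes S: "finite S" "uminus ` S = S" "generated_subgroup S = UNIV"
    and \<phi>_add: "\<And>x y. x \<in> order_bounded sums_of_squares (laplacian S) \<Longrightarrow>
      y \<in> order_bounded sums_of_squares (laplacian S) \<Longrightarrow> \<phi> (x + y) = \<phi> x + \<phi> y"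
    and \<phi>_scaleR: "\<And>r x. x \<in> order_bounded sums_of_squares (laplacian S) \<Longrightarrow> \<phi> (r *\<^sub>R x) = r * \<phi> x"
    and \<phi>_nonneg: "\<And>x. x \<in> sums_of_squares \<Longrightarrow>
      x \<in> order_bounded sums_of_squares (laplacian S) \<Longrightarrow> 0 \<le> \<phi> x"
    and \<phi>_laplacian: "\<phi> (laplacian S) = 1"
    and \<phi>_laplacian_sq: "\<phi> ((laplacian S)\<^sup>2) \<le> 0"
  shows "\<exists>(H :: ('g \<Rightarrow> real) set) ip \<pi> c.
    one_cocycle H ip \<pi> c \<and> (\<exists>g. c g \<noteq> 0) \<and> (\<Sum>s\<in>S. c s) = 0"
proof -
  define E where "E = order_bounded sums_of_squares (laplacian S)"
  note \<phi>_add = \<phi>_add[folded E_def] and \<phi>_scaleR = \<phi>_scaleR[folded E_def]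
    and \<phi>_nonneg = \<phi>_nonneg[folded E_def]
  note square_E = square_order_bounded[OF S, folded E_def]
    and prod_E = symmetric_product_order_bounded[OF S aug_proj_mem aug_proj_mem, folded E_def]
  define B where "B x y = \<phi> (star (aug_proj x) * aug_proj y + star (aug_proj y) * aug_proj x) / 2" for x y
  define gen where "gen g = Poly_Mapping.single g (1::real)" for g :: 'g
  \<comment> \<open>On the augmentation ideal \<open>T g\<close> is left multiplication by \<open>g\<close>.\<close>
  define T where "T g x = gen g * aug_proj x" for g x
  have B_diag: "B x x = \<phi> (star (aug_proj x) * aug_proj x)" for x
    using \<phi>_scaleR[OF square_E[OF aug_proj_mem], of 2 x] by (simp add: B_def scaleR_2)
  have semi: "spanned_semi_inner_product B gen"
  proof
    fix x y z :: "'g \<Rightarrow>\<^sub>0 real"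
    have "star (aug_proj (x + y)) * aug_proj z + star (aug_proj z) * aug_proj (x + y)
        = (star (aug_proj x) * aug_proj z + star (aug_proj z) * aug_proj x)
        + (star (aug_proj y) * aug_proj z + star (aug_proj z) * aug_proj y)"
      by (simp add: aug_proj_add algebra_simps)
    then show "B (x + y) z = B x z + B y z"
      unfolding B_def by (simp add: \<phi>_add[OF prod_E prod_E] add_divide_distrib)
    show "B (r *\<^sub>R x) y = r * B x y" for r
      using \<phi>_scaleR[OF prod_E, of r x y]
      by (simp add: B_def aug_proj_scaleR scaleR_mult_left scaleR_mult_right scaleR_add_right)
    show "B x y = B y x" by (simp add: B_def add.commute)
    show "0 \<le> B x x"
      unfolding B_diag by (intro \<phi>_nonneg square_E sums_of_squares_square aug_proj_mem)
  next
    have "a \<in> span (range gen)" for a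
    proof (induction a rule: poly_mapping_additive_induct)
      case (single g r)
      have "r *\<^sub>R gen g \<in> span (range gen)" by (intro span_scale span_base) simp
      then show ?case by (simp add: gen_def scaleR_single)
    qed (rule span_add)
    then show "span (range gen) = UNIV" by blast
  qed
  interpret spanned_semi_inner_product B gen by (rule semi)
  have proj_gen: "aug_proj (gen g) = gen g - 1" for g
    by (simp add: gen_def aug_proj_single)
  have proj_T: "aug_proj (T g x) = gen g * aug_proj x" for g x
    unfolding T_def using aug_proj_mem[of x]
    by (intro aug_proj_eq) (simp add: mem_augmentation_ideal)
  have star_gen: "star (gen g) * (gen g * a) = a" for g a
    by (simp add: gen_def mult_single flip: mult.assoc)
  have cocycle: "one_cocycle completion completion_inner (\<lambda>g f h. f (- g + h) - f (- g)) (\<lambda>g. coords (gen g))"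
  proof (rule one_cocycle_coords[OF semi])
    show "B (T g x) (T g y) = B x y" for g x y
      by (simp add: B_def proj_T mult.assoc star_gen)
    show "T g (x - y) = T g x - T g y" for g x y
      by (simp add: T_def aug_proj_diff right_diff_distrib)
    show "T g (gen h) = gen (g + h) - gen g" for g h
      by (simp add: T_def proj_gen right_diff_distrib) (simp add: gen_def mult_single)
    show "B x (gen 0) = 0" for x
      using form_eq_0[of "gen 0" x] B_diag[of "gen 0"] \<phi>_scaleR[OF prod_E, of 0]
      by (simp add: commute[of x] proj_gen) (simp add: gen_def)
  qed
  have "\<exists>g. coords (gen g) \<noteq> 0"
  proof (rule ccontr)
    assume "\<not> ?thesis"
    then have "B (gen g) (gen g) = 0" for g by (auto simp: coords_def fun_eq_iff)
    \<comment> \<open>Every summand of \<open>2\<Delta>\<close> would be killed by \<open>\<phi>\<close>, against \<open>\<phi>(\<Delta>) = 1\<close>.\<close>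
    then have zero: "\<phi> (star (gen g - 1) * (gen g - 1)) = 0" for g
      by (metis B_diag proj_gen)
    have mem: "star (gen g - 1) * (gen g - 1) \<in> E" for g
      using square_E[OF single_minus_one_mem] by (simp only: gen_def)
    have subE: "subspace E" unfolding E_def
      by (rule subspace_order_bounded[OF convex_cone_sums_of_squares laplacian_sums_of_squares[OF S(1,2)]])
    have "\<phi> (\<Sum>s\<in>A. star (gen s - 1) * (gen s - 1)) = 0" if "finite A" for A
      using that
    proof induction
      case empty
      then show ?case using \<phi>_scaleR[OF subspace_0[OF subE], of 0] by simp
    next
      case (insert s A)
      have "(\<Sum>r\<in>A. star (gen r - 1) * (gen r - 1)) \<in> E"
        by (intro subspace_sum[OF subE] mem)
      with insert show ?case using \<phi>_add[OF mem[of s]] zero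
        by (simp del: star_diff star_one)
    qed
    from this[OF S(1)] have "\<phi> (2 *\<^sub>R laplacian S) = 0"
      by (simp add: twice_laplacian[OF S(1,2)] gen_def)
    moreover have "laplacian S \<in> E" unfolding E_def
      by (rule order_bounded_unit[OF convex_cone_sums_of_squares laplacian_sums_of_squares[OF S(1,2)]])
    ultimately show False using \<phi>_scaleR[of "laplacian S" 2] \<phi>_laplacian by simp
  qed
  moreover have "(\<Sum>s\<in>S. coords (gen s)) = 0"
  proof -
    have proj: "aug_proj (\<Sum>s\<in>S. gen s) = - laplacian S"
      by (simp add: aug_proj_def laplacian_def gen_def augmentation_sum)
    have "star (- laplacian S) = - laplacian S"
      using star_scaleR[of "- 1" "laplacian S"] star_laplacian[OF S(2)] by simp
    then have "B (\<Sum>s\<in>S. gen s) (\<Sum>s\<in>S. gen s) \<le> 0"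
      unfolding B_diag proj using \<phi>_laplacian_sq by (simp add: power2_eq_square)
    then have "B (\<Sum>s\<in>S. gen s) (\<Sum>s\<in>S. gen s) = 0"
      using nonneg by (rule antisym)
    then show ?thesis
      unfolding coords_sum by (simp add: coords_def fun_eq_iff form_eq_0)
  qed
  ultimately show ?thesis using cocycle by blast
qed

theorem proposition1p1:
  fixes S :: "'g::group_add set"
  assumes "finite S"
    and "uminus ` S = S"
    and "generated_subgroup S = UNIV"
  shows "(\<exists>\<epsilon>::real. \<epsilon> > 0 \<and>
            (\<exists>(n::nat) \<omega>. (\<forall>i\<in>{1..n}. \<omega> i \<in> augmentation_ideal) \<and>
               (laplacian S)\<^sup>2 - \<epsilon> *\<^sub>R laplacian S = (\<Sum>i=1..n. star (\<omega> i) * \<omega> i)))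
       \<or> (\<exists>(H :: ('g \<Rightarrow> real) set) ip \<pi> c.
            one_cocycle H ip \<pi> c \<and> (\<exists>g. c g \<noteq> 0) \<and> (\<Sum>s\<in>S. c s) = 0)"
proof (cases "\<exists>\<epsilon>>0. (laplacian S)\<^sup>2 - \<epsilon> *\<^sub>R laplacian S \<in> sums_of_squares")
  case True
  then obtain \<epsilon> where "\<epsilon> > 0" "(laplacian S)\<^sup>2 - \<epsilon> *\<^sub>R laplacian S \<in> sums_of_squares"
    by blast
  then show ?thesis
    by (intro disjI1 exI[of _ \<epsilon>] conjI sums_of_squares_sequence)
next
  case False
  have "(laplacian S)\<^sup>2 = star (laplacian S) * laplacian S"
    by (simp add: star_laplacian[OF assms(2)] power2_eq_square)
  then have "(laplacian S)\<^sup>2 \<in> order_bounded sums_of_squares (laplacian S)"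
    using square_order_bounded[OF assms laplacian_mem] by simp
  moreover have "(laplacian S)\<^sup>2 - \<epsilon> *\<^sub>R laplacian S \<notin> sums_of_squares" if "\<epsilon> > 0" for \<epsilon>
    using False that by simp
  ultimately show ?thesis
    by (rule separation_by_state[OF convex_cone_sums_of_squares
          laplacian_sums_of_squares[OF assms(1,2)]])
      (assumption, rule disjI2, rule harmonic_cocycle_of_state[OF assms])
qed

end
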